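(* Let $M$ be a spacelike ($\lambda=-1$) (respectively, timelike ($\lambda=1$)) helix surface in $\mathbb{H}^3_{1,\tau}$ with constant angle function $\nu\ne0$, let $B=\nu^2(\tau^2-1)-\lambda$, and let $\gamma:\mathbb{R}\to\mathbb{H}^3_{1,\tau}$ be the curve associated with $M$ as follows. If $B>0$: $\gamma(x)=\big(\sqrt{w_{11}}\cos(\alpha_1x),-\lambda\sqrt{w_{11}}\sin(\alpha_1x),\sqrt{-w_{33}}\cos(\alpha_2x),\lambda\sqrt{-w_{33}}\sin(\alpha_2x)\big)$, where $\alpha_{1,2}=\frac{\sqrt\kappa}{2}\big(|\nu|\sqrt B\pm\frac B\tau\big)$, $w_{11}=\frac{4\tau}{\kappa^{3/2}B}\alpha_2$, $w_{33}=-\frac{4\tau}{\kappa^{3/2}B}\alpha_1$. If $B=0$: $\gamma(x)=\big(\nu^2\tau x,0,\frac{2}{\sqrt\kappa},\nu^2\tau\lambda x\big)$. If $B<0$: $\gamma=(\gamma_1,\gamma_2,\gamma_3,\gamma_4)$ with $\gamma_1=\frac{2\sqrt{\lambda+\nu^2}}{\sqrt{-\kappa B}}\cos(\alpha x)\sinh(\beta x)$, $\gamma_2=\frac{2\sqrt{\lambda+\nu^2}}{\sqrt{-\kappa B}}\sin(\alpha x)\sinh(\beta x)$, $\gamma_3=\frac{2}{\sqrt\kappa}\cos(\alpha x)\cosh(\beta x)-\frac{2\lambda\tau|\nu|}{\sqrt{-\kappa B}}\sin(\alpha x)\sinh(\beta x)$, $\gamma_4=\frac{2}{\sqrt\kappa}\sin(\alpha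 x)\cosh(\beta x)+\frac{2\lambda\tau|\nu|}{\sqrt{-\kappa B}}\cos(\alpha x)\sinh(\beta x)$, where $\alpha=-\frac{\sqrt\kappa}{2}\frac{B}{\lambda\tau}$, $\beta=|\nu|\frac{\sqrt{-\kappa B}}{2}$. Then $\gamma$ is a spacelike (respectively, timelike) general helix in $\mathbb{H}^3_{1,\tau}$ with axis $E_1$, so that it meets at a constant angle the fibers of the hyperbolic Hopf fibration. This angle is the same in all three cases (i.e. the angle function is given by one and the same expression in $\lambda$ and $\nu$ in the three cases).
   Context: Let $\kappa>0$ and $\tau>0$ be real constants. $\mathbb{R}^4_2$ is $\mathbb{R}^4$ with the metric $g_0=dx_1^2+dx_2^2-dx_3^2-dx_4^2$. The anti-de Sitter space is $\mathbb{H}^3_1(\kappa/4)=\{x\in\mathbb{R}^4: x_1^2+x_2^2-x_3^2-x_4^2=-4/\kappa\}$ with the induced Lorentzian metric $\langle\,,\rangle$. Let $X_1(q)=\frac{\sqrt\kappa}{2}(-x_2,x_1,-x_4,x_3)$ at $q=(x_1,x_2,x_3,x_4)$ (the hyperbolic Hopf vector field). The Berger-like metric is $g_\tau(X,Y)=\langle X,Y\rangle+(1-\tau^2)\langle X,X_1\rangle\langle Y,X_1\rangle$; $E_1=\tau^{-1}X_1$ is a unit timelike Killing field; $\mathbb{H}^3_{1,\tau}=(\mathbb{H}^3_1(\kappa/4),g_\tau)$. The hyperbolic Hopf fibration is $h(z,w)=\frac{\sqrt\kappa}{4}(2z\bar w,|z|^2+|w|^2)$ with $z=x_1+ix_2$,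 $w=x_3+ix_4$, with values in $\{(u_1,u_2,u_3): u_1^2+u_2^2-u_3^2=-1/\kappa,\ u_3>0\}$; its fibers are the orbits of $(z,w)\mapsto(e^{it}z,e^{it}w)$, and $E_1$ is tangent to them. For an oriented pseudo-Riemannian surface $M$ in $\mathbb{H}^3_{1,\tau}$ with unit normal $N$: $\lambda=g_\tau(N,N)\in\{-1,1\}$, angle function $\nu=\lambda g_\tau(N,E_1)$; $M$ is a helix surface if $\nu$ is constant. Throughout $\nu\ne0$, and then $\lambda+\nu^2>0$. A general helix is a non-null curve $c$ in a Lorentzian manifold $(P,h)$ admitting a Killing vector field $V$ of constant length along $c$ such that the angle function between $V$ and $c'$ is a non-zero constant; $V$ is called an axis of $c$. Here the angle function of $\gamma$ with $E_1$ is $g_\tau(\gamma',E_1)/\|\gamma'\|_\tau$, with $\|\gamma'\|_\tau=\sqrt{|g_\tau(\gamma',\gamma')|}$. *)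

theory Defs
  imports "HOL-Analysis.Analysis"
begin

section \<open>Smooth maps on open sets\<close>

text \<open>\<open>Ck_on n S f\<close>: all iterated directional derivatives of \<open>f\<close> up to order \<open>n\<close> exist and are
  continuous on \<open>S\<close>. Only meaningful for open \<open>S\<close>.\<close>

primrec Ck_on :: "nat \<Rightarrow> 'a::real_normed_vector set \<Rightarrow> ('a \<Rightarrow> 'b::real_normed_vector) \<Rightarrow> bool" where
  "Ck_on 0 S f \<longleftrightarrow> continuous_on S f"
| "Ck_on (Suc n) S f \<longleftrightarrow>
     (\<forall>x\<in>S. f differentiable (at x)) \<and> (\<forall>v. Ck_on n S (\<lambda>x. frechet_derivative f (at x) v))"

definition smooth_on :: "'a::real_normed_vector set \<Rightarrow> ('a \<Rightarrow> 'b::real_normed_vector) \<Rightarrow> bool" where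
  "smooth_on S f \<longleftrightarrow> (\<forall>n. Ck_on n S f)"


section \<open>The Berger-like anti-de Sitter space\<close>

definition ip22 :: "real^4 \<Rightarrow> real^4 \<Rightarrow> real" where
  "ip22 x y = x$1 * y$1 + x$2 * y$2 - x$3 * y$3 - x$4 * y$4"

definition ads :: "real \<Rightarrow> (real^4) set" where
  "ads \<kappa> = {x. ip22 x x = - 4 / \<kappa>}"

text \<open>The tangent space of \<open>ads \<kappa>\<close> at one of its points \<open>q\<close>, as the kernel of the differential of
  \<open>x \<mapsto> ip22 x x\<close>.\<close>

definition tangent_ads :: "real^4 \<Rightarrow> (real^4) set" where
  "tangent_ads q = {v. ip22 q v = 0}"

definition hopf_field :: "real \<Rightarrow> real^4 \<Rightarrow> real^4" where
  "hopf_field \<kappa> q = (sqrt \<kappa> / 2) *\<^sub>R vector [- q$2, q$1, - q$4, q$3]"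

text \<open>\<open>berger \<kappa> \<tau> q\<close> is the metric at the point \<open>q\<close>. It is given by a bilinear form on all of
  \<open>real^4\<close>, at every \<open>q\<close> in \<open>real^4\<close>; geometrically relevant is its restriction to
  \<open>tangent_ads q\<close> for \<open>q \<in> ads \<kappa>\<close>.\<close>

definition berger :: "real \<Rightarrow> real \<Rightarrow> real^4 \<Rightarrow> real^4 \<Rightarrow> real^4 \<Rightarrow> real" where
  "berger \<kappa> \<tau> q X Y =
     ip22 X Y + (1 - \<tau>\<^sup>2) * ip22 X (hopf_field \<kappa> q) * ip22 Y (hopf_field \<kappa> q)"

definition berger_norm :: "real \<Rightarrow> real \<Rightarrow> real^4 \<Rightarrow> real^4 \<Rightarrow> real" where
  "berger_norm \<kappa> \<tau> q X = sqrt \<bar>berger \<kappa> \<tau> q X X\<bar>"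

definition E1 :: "real \<Rightarrow> real \<Rightarrow> real^4 \<Rightarrow> real^4" where
  "E1 \<kappa> \<tau> q = (1 / \<tau>) *\<^sub>R hopf_field \<kappa> q"


section \<open>Killing fields\<close>

text \<open>A vector field on \<open>ads \<kappa>\<close> is represented by a smooth extension to \<open>real^4\<close> (one exists
  because \<open>ads \<kappa>\<close> is a closed submanifold). Along \<open>ads \<kappa>\<close>, brackets of such fields and derivatives
  in tangent directions depend only on the restrictions to \<open>ads \<kappa>\<close>.\<close>

definition vector_field_ads :: "real \<Rightarrow> (real^4 \<Rightarrow> real^4) \<Rightarrow> bool" where
  "vector_field_ads \<kappa> X \<longleftrightarrow> smooth_on UNIV X \<and> (\<forall>q\<in>ads \<kappa>. X q \<in> tangent_ads q)"

definition lie_bracket :: "(real^4 \<Rightarrow> real^4) \<Rightarrow> (real^4 \<Rightarrow> real^4) \<Rightarrow> real^4 \<Rightarrow> real^4" where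
  "lie_bracket X Y q = frechet_derivative Y (at q) (X q) - frechet_derivative X (at q) (Y q)"

text \<open>The Lie derivative of the metric along \<open>V\<close> vanishes:
  \<open>V(g(X,Y)) = g([V,X],Y) + g(X,[V,Y])\<close> for all vector fields \<open>X\<close>, \<open>Y\<close>.\<close>

definition killing_field :: "real \<Rightarrow> real \<Rightarrow> (real^4 \<Rightarrow> real^4) \<Rightarrow> bool" where
  "killing_field \<kappa> \<tau> V \<longleftrightarrow> vector_field_ads \<kappa> V \<and>
     (\<forall>X Y. vector_field_ads \<kappa> X \<longrightarrow> vector_field_ads \<kappa> Y \<longrightarrow>
       (\<forall>q\<in>ads \<kappa>. frechet_derivative (\<lambda>p. berger \<kappa> \<tau> p (X p) (Y p)) (at q) (V q)
          = berger \<kappa> \<tau> q (lie_bracket V X q) (Y q) + berger \<kappa> \<tau> q (X q) (lie_bracket V Y q)))"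


section \<open>Curves and general helices\<close>

definition velocity :: "(real \<Rightarrow> real^4) \<Rightarrow> real \<Rightarrow> real^4" where
  "velocity c x = vector_derivative c (at x)"

definition curve_ads :: "real \<Rightarrow> (real \<Rightarrow> real^4) \<Rightarrow> bool" where
  "curve_ads \<kappa> c \<longleftrightarrow> smooth_on UNIV c \<and> range c \<subseteq> ads \<kappa>"

definition non_null_curve :: "real \<Rightarrow> real \<Rightarrow> (real \<Rightarrow> real^4) \<Rightarrow> bool" where
  "non_null_curve \<kappa> \<tau> c \<longleftrightarrow>
     curve_ads \<kappa> c \<and> (\<forall>x. berger \<kappa> \<tau> (c x) (velocity c x) (velocity c x) \<noteq> 0)"

definition spacelike_curve :: "real \<Rightarrow> real \<Rightarrow> (real \<Rightarrow> real^4) \<Rightarrow> bool" where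
  "spacelike_curve \<kappa> \<tau> c \<longleftrightarrow>
     curve_ads \<kappa> c \<and> (\<forall>x. berger \<kappa> \<tau> (c x) (velocity c x) (velocity c x) > 0)"

definition timelike_curve :: "real \<Rightarrow> real \<Rightarrow> (real \<Rightarrow> real^4) \<Rightarrow> bool" where
  "timelike_curve \<kappa> \<tau> c \<longleftrightarrow>
     curve_ads \<kappa> c \<and> (\<forall>x. berger \<kappa> \<tau> (c x) (velocity c x) (velocity c x) < 0)"

text \<open>Only the velocity is normalised; for fields of constant length along \<open>c\<close>, dividing by that
  length as well would only change the angle function by a constant factor.\<close>

definition angle_function ::
  "real \<Rightarrow> real \<Rightarrow> (real^4 \<Rightarrow> real^4) \<Rightarrow> (real \<Rightarrow> real^4) \<Rightarrow> real \<Rightarrow> real" where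
  "angle_function \<kappa> \<tau> V c x =
     berger \<kappa> \<tau> (c x) (velocity c x) (V (c x)) / berger_norm \<kappa> \<tau> (c x) (velocity c x)"

definition general_helix_with_axis ::
  "real \<Rightarrow> real \<Rightarrow> (real^4 \<Rightarrow> real^4) \<Rightarrow> (real \<Rightarrow> real^4) \<Rightarrow> bool" where
  "general_helix_with_axis \<kappa> \<tau> V c \<longleftrightarrow>
     non_null_curve \<kappa> \<tau> c \<and>
     killing_field \<kappa> \<tau> V \<and>
     (\<exists>l. \<forall>x. berger_norm \<kappa> \<tau> (c x) (V (c x)) = l) \<and>
     (\<exists>a. a \<noteq> 0 \<and> (\<forall>x. angle_function \<kappa> \<tau> V c x = a))"


section \<open>The hyperbolic Hopf fibration\<close>

text \<open>With \<open>z = x\<^sub>1 + i x\<^sub>2\<close>, \<open>w = x\<^sub>3 + i x\<^sub>4\<close>; the target \<open>complex \<times> real\<close> stands for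
  three-dimensional space, \<open>(u\<^sub>1 + i u\<^sub>2, u\<^sub>3)\<close> being the point \<open>(u\<^sub>1, u\<^sub>2, u\<^sub>3)\<close>.\<close>

definition hopf_map :: "real \<Rightarrow> real^4 \<Rightarrow> complex \<times> real" where
  "hopf_map \<kappa> q = (let z = Complex (q$1) (q$2); w = Complex (q$3) (q$4) in
     (sqrt \<kappa> / 4) *\<^sub>R (2 * z * cnj w, (cmod z)\<^sup>2 + (cmod w)\<^sup>2))"

definition hopf_fiber :: "real \<Rightarrow> real^4 \<Rightarrow> (real^4) set" where
  "hopf_fiber \<kappa> q = {p \<in> ads \<kappa>. hopf_map \<kappa> p = hopf_map \<kappa> q}"

text \<open>The angle between \<open>c\<close> and the fiber through \<open>c x\<close> is computed from the velocity \<open>v\<close> of any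
  curve \<open>\<delta>\<close> running in the fiber and regular at \<open>c x\<close>. The absolute value makes it independent of
  the orientation of the fiber.\<close>

definition meets_hopf_fibers_at_constant_angle ::
  "real \<Rightarrow> real \<Rightarrow> (real \<Rightarrow> real^4) \<Rightarrow> bool" where
  "meets_hopf_fibers_at_constant_angle \<kappa> \<tau> c \<longleftrightarrow>
     (\<exists>a. \<forall>x \<delta> v.
        range \<delta> \<subseteq> hopf_fiber \<kappa> (c x) \<longrightarrow> \<delta> 0 = c x \<longrightarrow>
        (\<delta> has_vector_derivative v) (at 0) \<longrightarrow> v \<noteq> 0 \<longrightarrow>
        \<bar>berger \<kappa> \<tau> (c x) (velocity c x) v\<bar>
          / (berger_norm \<kappa> \<tau> (c x) (velocity c x) * berger_norm \<kappa> \<tau> (c x) v) = a)"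


section \<open>Helix surfaces\<close>

text \<open>A surface is a topological space \<open>M\<close> together with a map \<open>F\<close> into \<open>real^4\<close> (an immersion;
  \<open>F = id\<close> covers embedded surfaces). A chart is given through its inverse \<open>\<psi>\<close>, a homeomorphism
  of an open set \<open>U\<close> of the plane onto an open subset of \<open>M\<close>. Two charts in which \<open>F\<close> is
  a smooth immersion automatically differ by a smooth change of coordinates, so no separate atlas
  is needed.\<close>

definition immersion_chart ::
  "'m::topological_space set \<Rightarrow> ('m \<Rightarrow> real^4) \<Rightarrow> (real^2) set \<Rightarrow> (real^2 \<Rightarrow> 'm) \<Rightarrow> bool" where
  "immersion_chart M F U \<psi> \<longleftrightarrow>
     open U \<and> openin (top_of_set M) (\<psi> ` U) \<and> (\<exists>\<phi>. homeomorphism U (\<psi> ` U) \<psi> \<phi>) \<and>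
     smooth_on U (F \<circ> \<psi>) \<and> (\<forall>u\<in>U. inj (frechet_derivative (F \<circ> \<psi>) (at u)))"

text \<open>\<open>lam\<close> is the causal character \<open>g(N,N)\<close> of the unit normal \<open>N\<close> along \<open>F\<close>: \<open>-1\<close> for
  spacelike and \<open>1\<close> for timelike surfaces. Existence of a non-null normal makes the induced metric
  nondegenerate, and a global smooth choice of \<open>N\<close> amounts to an orientation because \<open>ads \<kappa>\<close>
  is orientable.\<close>

definition oriented_surface ::
  "real \<Rightarrow> real \<Rightarrow> 'm::{t2_space,second_countable_topology} set \<Rightarrow> ('m \<Rightarrow> real^4) \<Rightarrow>
   ('m \<Rightarrow> real^4) \<Rightarrow> real \<Rightarrow> bool" where
  "oriented_surface \<kappa> \<tau> M F N lam \<longleftrightarrow>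
     M \<noteq> {} \<and> F ` M \<subseteq> ads \<kappa> \<and> lam \<in> {-1, 1} \<and>
     (\<forall>p\<in>M. N p \<in> tangent_ads (F p) \<and> berger \<kappa> \<tau> (F p) (N p) (N p) = lam) \<and>
     (\<forall>p\<in>M. \<exists>U \<psi>. immersion_chart M F U \<psi> \<and> p \<in> \<psi> ` U \<and> smooth_on U (N \<circ> \<psi>) \<and>
        (\<forall>u\<in>U. \<forall>v.
           berger \<kappa> \<tau> (F (\<psi> u)) (N (\<psi> u)) (frechet_derivative (F \<circ> \<psi>) (at u) v) = 0))"

definition helix_surface ::
  "real \<Rightarrow> real \<Rightarrow> 'm::{t2_space,second_countable_topology} set \<Rightarrow> ('m \<Rightarrow> real^4) \<Rightarrow>
   ('m \<Rightarrow> real^4) \<Rightarrow> real \<Rightarrow> real \<Rightarrow> bool" where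
  "helix_surface \<kappa> \<tau> M F N lam \<nu> \<longleftrightarrow>
     oriented_surface \<kappa> \<tau> M F N lam \<and>
     (\<forall>p\<in>M. lam * berger \<kappa> \<tau> (F p) (N p) (E1 \<kappa> \<tau> (F p)) = \<nu>)"


section \<open>The curve associated with a helix surface\<close>

definition helix_B :: "real \<Rightarrow> real \<Rightarrow> real \<Rightarrow> real" where
  "helix_B \<tau> lam \<nu> = \<nu>\<^sup>2 * (\<tau>\<^sup>2 - 1) - lam"

definition curve_pos :: "real \<Rightarrow> real \<Rightarrow> real \<Rightarrow> real \<Rightarrow> real \<Rightarrow> real^4" where
  "curve_pos \<kappa> \<tau> lam \<nu> x =
     (let B = helix_B \<tau> lam \<nu>;
          \<alpha>1 = sqrt \<kappa> / 2 * (\<bar>\<nu>\<bar> * sqrt B + B / \<tau>);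
          \<alpha>2 = sqrt \<kappa> / 2 * (\<bar>\<nu>\<bar> * sqrt B - B / \<tau>);
          w11 = 4 * \<tau> / (\<kappa> powr (3/2) * B) * \<alpha>2;
          w33 = - (4 * \<tau> / (\<kappa> powr (3/2) * B)) * \<alpha>1
      in vector [sqrt w11 * cos (\<alpha>1 * x), - lam * sqrt w11 * sin (\<alpha>1 * x),
                 sqrt (- w33) * cos (\<alpha>2 * x), lam * sqrt (- w33) * sin (\<alpha>2 * x)])"

definition curve_zero :: "real \<Rightarrow> real \<Rightarrow> real \<Rightarrow> real \<Rightarrow> real \<Rightarrow> real^4" where
  "curve_zero \<kappa> \<tau> lam \<nu> x = vector [\<nu>\<^sup>2 * \<tau> * x, 0, 2 / sqrt \<kappa>, \<nu>\<^sup>2 * \<tau> * lam * x]"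

definition curve_neg :: "real \<Rightarrow> real \<Rightarrow> real \<Rightarrow> real \<Rightarrow> real \<Rightarrow> real^4" where
  "curve_neg \<kappa> \<tau> lam \<nu> x =
     (let B = helix_B \<tau> lam \<nu>;
          \<alpha> = - (sqrt \<kappa> / 2) * (B / (lam * \<tau>));
          \<beta> = \<bar>\<nu>\<bar> * (sqrt (- \<kappa> * B) / 2);
          a = 2 * sqrt (lam + \<nu>\<^sup>2) / sqrt (- \<kappa> * B);
          b = 2 / sqrt \<kappa>;
          d = 2 * lam * \<tau> * \<bar>\<nu>\<bar> / sqrt (- \<kappa> * B)
      in vector [a * cos (\<alpha> * x) * sinh (\<beta> * x),
                 a * sin (\<alpha> * x) * sinh (\<beta> * x),
                 b * cos (\<alpha> * x) * cosh (\<beta> * x) - d * sin (\<alpha> * x) * sinh (\<beta> * x),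
                 b * sin (\<alpha> * x) * cosh (\<beta> * x) + d * cos (\<alpha> * x) * sinh (\<beta> * x)])"

definition associated_curve :: "real \<Rightarrow> real \<Rightarrow> real \<Rightarrow> real \<Rightarrow> real \<Rightarrow> real^4" where
  "associated_curve \<kappa> \<tau> lam \<nu> =
     (if helix_B \<tau> lam \<nu> > 0 then curve_pos \<kappa> \<tau> lam \<nu>
      else if helix_B \<tau> lam \<nu> = 0 then curve_zero \<kappa> \<tau> lam \<nu>
      else curve_neg \<kappa> \<tau> lam \<nu>)"

end

theory Submission
  imports Defs
begin

text \<open>Write \<open>H\<close> for the Hopf field and \<open>r = lam + \<nu>\<^sup>2\<close>. In all three cases
  \<open>ip22 \<gamma>' \<gamma>' = r B / \<tau>\<^sup>2\<close> and \<open>ip22 \<gamma>' H = - lam r / \<tau>\<close>, so that \<open>\<gamma>\<close> has the constant squared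
  speed \<open>- lam r\<close> in the Berger metric and its angle function with \<open>E1\<close> is \<open>- lam sqrt r\<close>; a velocity
  tangent to a Hopf fiber is a multiple of \<open>H\<close>. The surface enters only through \<open>r > 0\<close>. Since \<open>r\<close> is
  the square of the component of the unit normal orthogonal to \<open>E1\<close>, which lies in a positive definite
  plane, \<open>r \<ge> 0\<close>. If \<open>r = 0\<close>, then \<open>N\<close> is parallel to \<open>E1\<close> and the surface is everywhere
  orthogonal to \<open>H\<close>, which is impossible because the orthogonal complement of \<open>H\<close> is a contact
  distribution. (For \<open>lam = -1\<close> and \<open>r = 0\<close> the curve \<open>\<gamma>\<close> would be constant.)\<close>

section \<open>Smoothness\<close>

text \<open>Induction on the order of differentiation, for all members of \<open>C\<close> at once:
  a directional derivative of a member is again a member, so no iterated derivative has to be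
  computed.\<close>

lemma smooth_on_UNIV_if_closed_class:
  assumes "f \<in> C"
    and diff: "\<And>f x. f \<in> C \<Longrightarrow> f differentiable (at x)"
    and closed: "\<And>f v. f \<in> C \<Longrightarrow> (\<lambda>x. frechet_derivative f (at x) v) \<in> C"
  shows "smooth_on UNIV f"
proof -
  have "Ck_on n UNIV f" if "f \<in> C" for n f
    using that
  proof (induction n arbitrary: f)
    case 0
    then show ?case
      by (simp add: diff differentiable_imp_continuous_on differentiable_on_def differentiable_at_withinI)
  next
    case (Suc n)
    then show ?case by (simp add: diff closed)
  qed
  with assms(1) show ?thesis by (simp add: smooth_on_def)
qed

text \<open>The class is that of the affine maps: the derivative of a linear map in a fixed
  direction is a constant, so the linear maps alone would not be closed.\<close>

lemma bounded_linear_imp_smooth_on: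
  assumes "bounded_linear f"
  shows "smooth_on UNIV f"
proof (rule smooth_on_UNIV_if_closed_class)
  let ?C = "{\<lambda>x. L x + c | (L :: 'a \<Rightarrow> 'b) c. bounded_linear L}"
  have D: "((\<lambda>x. L x + c) has_derivative L) (at x)" if "bounded_linear L" for L :: "'a \<Rightarrow> 'b" and c x
    using bounded_linear_imp_has_derivative[OF that] by (auto intro!: derivative_eq_intros)
  show "f \<in> ?C"
    using assms by (auto intro!: exI[of _ f] exI[of _ 0])
  show "g differentiable (at x)" if "g \<in> ?C" for g x
  proof -
    from that obtain L c where "g = (\<lambda>x. L x + c)" "bounded_linear L" by blast
    then show ?thesis using D unfolding differentiable_def by blast
  qed
  show "(\<lambda>x. frechet_derivative g (at x) v) \<in> ?C" if "g \<in> ?C" for g v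
  proof -
    from that obtain L c where g: "g = (\<lambda>x. L x + c)" "bounded_linear L" by blast
    then have "(\<lambda>x. frechet_derivative g (at x) v) = (\<lambda>x. 0 + L v)"
      unfolding g(1) using frechet_derivative_at[OF D[OF g(2)], of c] by (metis add_0)
    moreover have "bounded_linear (\<lambda>_ :: 'a. 0 :: 'b)" by (rule bounded_linear_zero)
    ultimately show ?thesis by (intro CollectI exI[of _ "\<lambda>_. 0"] exI[of _ "L v"] conjI)
  qed
qed

text \<open>A class of real functions that is closed under derivatives and contains the coordinates
  of all three kinds of associated curves.\<close>

inductive elementary :: "(real \<Rightarrow> real) \<Rightarrow> bool" where
  const: "elementary (\<lambda>x. c)"
| ident: "elementary (\<lambda>x. x)"
| sin: "elementary (\<lambda>x. sin (a * x))"
| cos: "elementary (\<lambda>x. cos (a * x))"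
| sinh: "elementary (\<lambda>x. sinh (a * x))"
| cosh: "elementary (\<lambda>x. cosh (a * x))"
| add: "elementary f \<Longrightarrow> elementary g \<Longrightarrow> elementary (\<lambda>x. f x + g x)"
| mult: "elementary f \<Longrightarrow> elementary g \<Longrightarrow> elementary (\<lambda>x. f x * g x)"

lemma elementary_diff:
  assumes "elementary f" "elementary g"
  shows "elementary (\<lambda>x. f x - g x)"
  using elementary.add[OF assms(1) elementary.mult[OF elementary.const assms(2), of "-1"]] by simp

lemma elementary_uminus: "elementary f \<Longrightarrow> elementary (\<lambda>x. - f x)"
  using elementary_diff[OF elementary.const[of 0]] by simp

text \<open>This is the closure property that allows differentiation to be repeated without leaving
  the class.\<close>

lemma elementary_derivative:
  "elementary f \<Longrightarrow> \<exists>g. elementary g \<and> (\<forall>x. (f has_real_derivative g x) (at x))"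
proof (induction rule: elementary.induct)
  case (const c)
  then show ?case by (intro exI[of _ "\<lambda>_. 0"]) (auto intro: elementary.intros)
next
  case ident
  then show ?case by (intro exI[of _ "\<lambda>_. 1"]) (auto intro: elementary.intros)
next
  case (sin a)
  show ?case
    by (intro exI[of _ "\<lambda>x. a * cos (a * x)"])
       (auto intro!: elementary.intros derivative_eq_intros)
next
  case (cos a)
  show ?case
    by (intro exI[of _ "\<lambda>x. - a * sin (a * x)"] conjI elementary.mult elementary.const elementary.sin allI)
       (auto intro!: derivative_eq_intros)
next
  case (sinh a)
  show ?case
    by (intro exI[of _ "\<lambda>x. a * cosh (a * x)"])
       (auto intro!: elementary.intros derivative_eq_intros)
next
  case (cosh a)
  show ?case
    by (intro exI[of _ "\<lambda>x. a * sinh (a * x)"])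
       (auto intro!: elementary.intros derivative_eq_intros)
next
  case (add f g)
  then obtain f' g' where "elementary f'" "elementary g'"
    "\<And>x. (f has_real_derivative f' x) (at x)" "\<And>x. (g has_real_derivative g' x) (at x)" by blast
  then show ?case
    by (intro exI[of _ "\<lambda>x. f' x + g' x"]) (auto intro!: elementary.intros derivative_eq_intros)
next
  case (mult f g)
  then obtain f' g' where "elementary f'" "elementary g'"
    "\<And>x. (f has_real_derivative f' x) (at x)" "\<And>x. (g has_real_derivative g' x) (at x)" by blast
  with mult.hyps show ?case
    by (intro exI[of _ "\<lambda>x. f' x * g x + f x * g' x"])
       (auto intro!: elementary.intros derivative_eq_intros)
qed

section \<open>Curves in four-space given by their coordinates\<close>

lemma vector_4_nth [simp]:
  "(vector [w, x, y, z] :: 'a::zero^4) $ 1 = w"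
  "(vector [w, x, y, z] :: 'a::zero^4) $ 2 = x"
  "(vector [w, x, y, z] :: 'a::zero^4) $ 3 = y"
  "(vector [w, x, y, z] :: 'a::zero^4) $ 4 = z"
  unfolding vector_def by simp_all

text \<open>In the standard basis the curve is a sum of real functions times constant vectors, to
  which the usual derivative rules apply.\<close>

lemma has_vector_derivative_vector4:
  fixes f1 :: "real \<Rightarrow> real"
  assumes "(f1 has_real_derivative d1) (at x)" "(f2 has_real_derivative d2) (at x)"
    "(f3 has_real_derivative d3) (at x)" "(f4 has_real_derivative d4) (at x)"
  shows "((\<lambda>x. vector [f1 x, f2 x, f3 x, f4 x] :: real^4)
    has_vector_derivative vector [d1, d2, d3, d4]) (at x)"
proof -
  have decomp: "(vector [a, b, c, d] :: real^4)
      = a *\<^sub>R axis 1 1 + b *\<^sub>R axis 2 1 + c *\<^sub>R axis 3 1 + d *\<^sub>R axis 4 1" for a b c d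
    by (simp add: vec_eq_iff forall_4 axis_def)
  show ?thesis
    unfolding decomp using assms by (auto intro!: derivative_eq_intros)
qed

lemma smooth_on_vector4:
  assumes "elementary f1" "elementary f2" "elementary f3" "elementary f4"
  shows "smooth_on UNIV (\<lambda>x. vector [f1 x, f2 x, f3 x, f4 x] :: real^4)"
proof (rule smooth_on_UNIV_if_closed_class)
  let ?C = "{\<lambda>x. vector [f1 x, f2 x, f3 x, f4 x] :: real^4 | f1 f2 f3 f4.
    elementary f1 \<and> elementary f2 \<and> elementary f3 \<and> elementary f4}"
  \<comment> \<open>The derivative in the real direction \<open>v\<close> is \<open>v\<close> times
    the velocity, and the factor \<open>v\<close> is absorbed into the coordinates as an elementary
    constant.\<close>
  have D: "\<exists>g. (\<forall>x. (f has_vector_derivative g x) (at x)) \<and> (\<forall>v. (\<lambda>x. v *\<^sub>R g x) \<in> ?C)"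
    if "f \<in> ?C" for f
  proof -
    from that obtain f1 f2 f3 f4 where f: "f = (\<lambda>x. vector [f1 x, f2 x, f3 x, f4 x])"
      "elementary f1" "elementary f2" "elementary f3" "elementary f4" by blast
    then obtain g1 g2 g3 g4 where g: "elementary g1" "elementary g2" "elementary g3" "elementary g4"
      "\<And>x. (f1 has_real_derivative g1 x) (at x)" "\<And>x. (f2 has_real_derivative g2 x) (at x)"
      "\<And>x. (f3 has_real_derivative g3 x) (at x)" "\<And>x. (f4 has_real_derivative g4 x) (at x)"
      by (meson elementary_derivative)
    have "(\<lambda>x. v *\<^sub>R (vector [g1 x, g2 x, g3 x, g4 x] :: real^4)) \<in> ?C" for v
    proof -
      have "(\<lambda>x. v *\<^sub>R (vector [g1 x, g2 x, g3 x, g4 x] :: real^4))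
          = (\<lambda>x. vector [v * g1 x, v * g2 x, v * g3 x, v * g4 x])"
        by (simp add: fun_eq_iff vec_eq_iff forall_4)
      then show ?thesis
        by (intro CollectI exI conjI) (assumption | intro elementary.mult elementary.const g)+
    qed
    moreover have "(f has_vector_derivative vector [g1 x, g2 x, g3 x, g4 x]) (at x)" for x
      unfolding f(1) by (intro has_vector_derivative_vector4 g)
    ultimately show ?thesis
      by (intro exI[of _ "\<lambda>x. vector [g1 x, g2 x, g3 x, g4 x]"] conjI allI)
  qed
  show "(\<lambda>x. vector [f1 x, f2 x, f3 x, f4 x] :: real^4) \<in> ?C"
    by (intro CollectI exI conjI) (rule refl assms)+
  show "f differentiable (at x)" if "f \<in> ?C" for f x
    using D[OF that] has_vector_derivative_def differentiable_def by blast
  show "(\<lambda>x. frechet_derivative f (at x) v) \<in> ?C" if "f \<in> ?C" for f v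
  proof -
    obtain g where g: "\<And>x. (f has_vector_derivative g x) (at x)" "(\<lambda>x. v *\<^sub>R g x) \<in> ?C"
      using D[OF \<open>f \<in> ?C\<close>] by blast
    have "frechet_derivative f (at x) v = v *\<^sub>R g x" for x
      using frechet_derivative_at[OF g(1)[unfolded has_vector_derivative_def], of x, symmetric]
      by (simp add: fun_eq_iff)
    with g(2) show ?thesis by simp
  qed
qed


section \<open>Symmetry of second derivatives\<close>

text \<open>The mean value theorem is applied twice, first along \<open>u\<close> to a difference of
  values of \<open>g\<close>, then along \<open>v\<close> to the derivative of \<open>g\<close> in
  direction \<open>u\<close>.\<close>

lemma second_difference_mean_value:
  fixes g :: "'a::real_normed_vector \<Rightarrow> real"
  assumes "s > 0"
    and g: "\<And>p t. 0 \<le> p \<Longrightarrow> p \<le> s \<Longrightarrow> 0 \<le> t \<Longrightarrow> t \<le> s \<Longrightarrow>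
      g differentiable at (x + p *\<^sub>R u + t *\<^sub>R v)"
    and gu: "\<And>p t. 0 \<le> p \<Longrightarrow> p \<le> s \<Longrightarrow> 0 \<le> t \<Longrightarrow> t \<le> s \<Longrightarrow>
      (\<lambda>y. frechet_derivative g (at y) u) differentiable at (x + p *\<^sub>R u + t *\<^sub>R v)"
  obtains p t where "0 < p" "p < s" "0 < t" "t < s"
    "g (x + s *\<^sub>R u + s *\<^sub>R v) - g (x + s *\<^sub>R u) - g (x + s *\<^sub>R v) + g x =
      s\<^sup>2 * frechet_derivative (\<lambda>y. frechet_derivative g (at y) u) (at (x + p *\<^sub>R u + t *\<^sub>R v)) v"
proof -
  let ?gu = "\<lambda>y. frechet_derivative g (at y) u"
  \<comment> \<open>The second difference is \<open>?\<phi> s - ?\<phi> 0\<close>. The summand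
    \<open>0 *\<^sub>R v\<close> is kept so that both terms are instances of \<open>D1\<close>, with
    \<open>t = s\<close> and \<open>t = 0\<close>.\<close>
  let ?\<phi> = "\<lambda>p. g (x + p *\<^sub>R u + s *\<^sub>R v) - g (x + p *\<^sub>R u + 0 *\<^sub>R v)"
  have D1: "((\<lambda>p. g (x + p *\<^sub>R u + t *\<^sub>R v)) has_real_derivative ?gu (x + p *\<^sub>R u + t *\<^sub>R v)) (at p)"
    if "0 \<le> p" "p \<le> s" "0 \<le> t" "t \<le> s" for p t
  proof -
    have "(g has_derivative frechet_derivative g (at (x + p *\<^sub>R u + t *\<^sub>R v))) (at (x + p *\<^sub>R u + t *\<^sub>R v))"
      using g[OF that] by (simp add: frechet_derivative_works)
    then have "((\<lambda>p. g (x + p *\<^sub>R u + t *\<^sub>R v)) has_derivative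
        (\<lambda>h. frechet_derivative g (at (x + p *\<^sub>R u + t *\<^sub>R v)) (h *\<^sub>R u))) (at p)"
      by (rule has_derivative_compose[rotated]) (auto intro!: derivative_eq_intros)
    then show ?thesis
      by (simp add: has_field_derivative_def linear_cmul[OF linear_frechet_derivative[OF g[OF that]]]
          mult_commute_abs)
  qed
  have D2: "((\<lambda>t. ?gu (x + p *\<^sub>R u + t *\<^sub>R v)) has_real_derivative
      frechet_derivative ?gu (at (x + p *\<^sub>R u + t *\<^sub>R v)) v) (at t)"
    if "0 \<le> p" "p \<le> s" "0 \<le> t" "t \<le> s" for p t
  proof -
    have "(?gu has_derivative frechet_derivative ?gu (at (x + p *\<^sub>R u + t *\<^sub>R v))) (at (x + p *\<^sub>R u + t *\<^sub>R v))"
      using gu[OF that] by (simp add: frechet_derivative_works)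
    then have "((\<lambda>t. ?gu (x + p *\<^sub>R u + t *\<^sub>R v)) has_derivative
        (\<lambda>h. frechet_derivative ?gu (at (x + p *\<^sub>R u + t *\<^sub>R v)) (h *\<^sub>R v))) (at t)"
      by (rule has_derivative_compose[rotated]) (auto intro!: derivative_eq_intros)
    then show ?thesis
      by (simp add: has_field_derivative_def linear_cmul[OF linear_frechet_derivative[OF gu[OF that]]]
          mult_commute_abs)
  qed
  have "(?\<phi> has_real_derivative ?gu (x + p *\<^sub>R u + s *\<^sub>R v) - ?gu (x + p *\<^sub>R u + 0 *\<^sub>R v)) (at p)"
    if "0 \<le> p" "p \<le> s" for p
    using that \<open>s > 0\<close> by (intro DERIV_diff D1) auto
  from MVT2[OF \<open>s > 0\<close> this] obtain p where p: "0 < p" "p < s"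
    "?\<phi> s - ?\<phi> 0 = (s - 0) * (?gu (x + p *\<^sub>R u + s *\<^sub>R v) - ?gu (x + p *\<^sub>R u + 0 *\<^sub>R v))"
    by blast
  from MVT2[OF \<open>s > 0\<close> D2[of p]] p obtain t where t: "0 < t" "t < s"
    "?gu (x + p *\<^sub>R u + s *\<^sub>R v) - ?gu (x + p *\<^sub>R u + 0 *\<^sub>R v)
      = (s - 0) * frechet_derivative ?gu (at (x + p *\<^sub>R u + t *\<^sub>R v)) v"
    by auto
  show thesis
    using p t by (intro that[of p t]) (auto simp: power2_eq_square algebra_simps)
qed

text \<open>Both mixed derivatives, each at some point near \<open>x\<close>, arise from one and the
  same second difference divided by \<open>s\<^sup>2\<close>; continuity then carries the equality
  to \<open>x\<close>.\<close>

lemma second_derivative_symmetric_real: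
  fixes g :: "'a::real_normed_vector \<Rightarrow> real"
  assumes "open S" "Ck_on (Suc (Suc 0)) S g" "x \<in> S"
  shows "frechet_derivative (\<lambda>y. frechet_derivative g (at y) u) (at x) v =
    frechet_derivative (\<lambda>y. frechet_derivative g (at y) v) (at x) u"
proof -
  let ?D = "\<lambda>u v y. frechet_derivative (\<lambda>y. frechet_derivative g (at y) u) (at y) v"
  have g: "g differentiable at y" and gw: "(\<lambda>y. frechet_derivative g (at y) w) differentiable at y"
    if "y \<in> S" for y w
    using assms(2) that by auto
  have cont: "(?D u v \<longlongrightarrow> ?D u v x) (nhds x)" for u v
  proof -
    have "continuous_on S (?D u v)" using assms(2) by simp
    with assms(1,3) have "isCont (?D u v) x" by (simp add: continuous_on_eq_continuous_at)
    then show ?thesis unfolding isCont_def by (rule iffD1[OF tendsto_at_iff_tendsto_nhds])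
  qed
  have "\<bar>?D u v x - ?D v u x\<bar> \<le> e" if "e > 0" for e
  proof -
    have "\<forall>\<^sub>F y in nhds x. y \<in> S \<and> dist (?D u v y) (?D u v x) < e / 2 \<and> dist (?D v u y) (?D v u x) < e / 2"
      using assms(1,3) \<open>e > 0\<close> cont[of u v] cont[of v u]
      by (intro eventually_conj eventually_nhds_in_open tendstoD)
         simp_all
    then obtain d where "d > 0" and d: "\<And>y. dist y x < d \<Longrightarrow>
        y \<in> S \<and> dist (?D u v y) (?D u v x) < e / 2 \<and> dist (?D v u y) (?D v u x) < e / 2"
      unfolding eventually_nhds_metric by blast
    \<comment> \<open>With this step the parallelogram spanned by \<open>s *\<^sub>R u\<close> and
      \<open>s *\<^sub>R v\<close> at \<open>x\<close> stays within distance \<open>d\<close> of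
      \<open>x\<close>; the summand 1 keeps the denominator positive even if \<open>u\<close> and
      \<open>v\<close> both vanish.\<close>
    define s where "s = d / (2 * (norm u + norm v + 1))"
    have s: "s > 0" "s * (norm u + norm v) < d"
    proof -
      have "norm u + norm v + 1 > 0" by (smt (verit) norm_ge_zero)
      with \<open>d > 0\<close> show "s > 0" unfolding s_def by simp
      have "s * (norm u + norm v + 1) = d / 2"
        using \<open>norm u + norm v + 1 > 0\<close> unfolding s_def by (simp add: divide_simps)
      with \<open>d > 0\<close> \<open>s > 0\<close> show "s * (norm u + norm v) < d"
        by (simp add: distrib_left)
    qed
    have close: "dist (x + p *\<^sub>R u + t *\<^sub>R v) x < d" if "0 \<le> p" "p \<le> s" "0 \<le> t" "t \<le> s" for p t
    proof -
      have "dist (x + p *\<^sub>R u + t *\<^sub>R v) x = norm (p *\<^sub>R u + t *\<^sub>R v)"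
        by (simp add: dist_norm algebra_simps)
      also have "\<dots> \<le> p * norm u + t * norm v"
        using norm_triangle_ineq[of "p *\<^sub>R u" "t *\<^sub>R v"] that by simp
      also have "\<dots> \<le> s * norm u + s * norm v"
        using that by (intro add_mono mult_right_mono) auto
      finally show ?thesis using s by (simp add: distrib_left)
    qed
    have close': "dist (x + p *\<^sub>R v + t *\<^sub>R u) x < d" if "0 \<le> p" "p \<le> s" "0 \<le> t" "t \<le> s" for p t
      using close[of t p] that by (simp add: add_ac)
    obtain p t where pt: "0 < p" "p < s" "0 < t" "t < s"
      "g (x + s *\<^sub>R u + s *\<^sub>R v) - g (x + s *\<^sub>R u) - g (x + s *\<^sub>R v) + g x
        = s\<^sup>2 * ?D u v (x + p *\<^sub>R u + t *\<^sub>R v)"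
    proof (rule second_difference_mean_value[of s g x u v])
    qed (use s(1) d close g gw in auto)
    obtain p' t' where pt': "0 < p'" "p' < s" "0 < t'" "t' < s"
      "g (x + s *\<^sub>R v + s *\<^sub>R u) - g (x + s *\<^sub>R v) - g (x + s *\<^sub>R u) + g x
        = s\<^sup>2 * ?D v u (x + p' *\<^sub>R v + t' *\<^sub>R u)"
    proof (rule second_difference_mean_value[of s g x v u])
    qed (use s(1) d close' g gw in auto)
    \<comment> \<open>The second difference does not change when \<open>u\<close> and
      \<open>v\<close> are exchanged.\<close>
    have "x + s *\<^sub>R v + s *\<^sub>R u = x + s *\<^sub>R u + s *\<^sub>R v" by simp
    with pt(5) pt'(5) have "s\<^sup>2 * ?D u v (x + p *\<^sub>R u + t *\<^sub>R v) = s\<^sup>2 * ?D v u (x + p' *\<^sub>R v + t' *\<^sub>R u)"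
      by (simp add: algebra_simps)
    then have "?D u v (x + p *\<^sub>R u + t *\<^sub>R v) = ?D v u (x + p' *\<^sub>R v + t' *\<^sub>R u)"
      using s(1) by simp
    moreover have "dist (?D u v (x + p *\<^sub>R u + t *\<^sub>R v)) (?D u v x) < e / 2"
      using d[OF close[of p t]] pt by simp
    moreover have "dist (?D v u (x + p' *\<^sub>R v + t' *\<^sub>R u)) (?D v u x) < e / 2"
      using d[OF close'[of p' t']] pt' by simp
    ultimately show ?thesis unfolding dist_real_def by linarith
  qed
  then have "\<bar>?D u v x - ?D v u x\<bar> \<le> 0" by (rule field_le_epsilon) simp
  then show ?thesis by simp
qed

section \<open>From real-valued to vector-valued maps\<close>

lemma frechet_derivative_inner_left:
  fixes f :: "'a::real_normed_vector \<Rightarrow> 'b::real_inner"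
  assumes "f differentiable at x"
  shows "(\<lambda>y. f y \<bullet> w) differentiable at x"
    and "frechet_derivative (\<lambda>y. f y \<bullet> w) (at x) v = frechet_derivative f (at x) v \<bullet> w"
proof -
  have D: "((\<lambda>y. f y \<bullet> w) has_derivative (\<lambda>v. frechet_derivative f (at x) v \<bullet> w)) (at x)"
    using assms by (auto simp: frechet_derivative_works intro: has_derivative_inner_left)
  then show "(\<lambda>y. f y \<bullet> w) differentiable at x" by (auto simp: differentiable_def)
  show "frechet_derivative (\<lambda>y. f y \<bullet> w) (at x) v = frechet_derivative f (at x) v \<bullet> w"
    using frechet_derivative_at[OF D] by metis
qed

text \<open>On an open set the derivative at a point depends only on values inside the set. This is
  what permits rewriting under \<open>Ck_on\<close> with identities between derivatives that hold on
  \<open>S\<close> only.\<close>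

lemma Ck_on_cong:
  assumes "open S" "\<And>x. x \<in> S \<Longrightarrow> f x = g x" "Ck_on n S f"
  shows "Ck_on n S g"
  using assms(2,3)
proof (induction n arbitrary: f g)
  case 0
  then show ?case using continuous_on_cong by (metis Ck_on.simps(1))
next
  case (Suc n)
  have D: "(g has_derivative frechet_derivative f (at x)) (at x)" if "x \<in> S" for x
    using Suc.prems that assms(1)
    by (intro has_derivative_transform_within_open[of f _ x UNIV S g])
       (auto simp: frechet_derivative_works)
  then have "g differentiable at x" if "x \<in> S" for x
    using that differentiable_def by blast
  moreover have eq: "frechet_derivative f (at x) v = frechet_derivative g (at x) v" if "x \<in> S" for x v
    using frechet_derivative_at[OF D[OF that]] by simp
  moreover have "Ck_on n S (\<lambda>x. frechet_derivative g (at x) v)" for v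
  proof (rule Suc.IH[of "\<lambda>x. frechet_derivative f (at x) v", rotated])
    show "Ck_on n S (\<lambda>x. frechet_derivative f (at x) v)" using Suc.prems(2) by simp
  qed (simp add: eq)
  ultimately show ?case by simp
qed

lemma Ck_on_inner_left:
  fixes f :: "'a::real_normed_vector \<Rightarrow> 'b::real_inner"
  assumes "open S" "Ck_on n S f"
  shows "Ck_on n S (\<lambda>x. f x \<bullet> w)"
  using assms(2)
proof (induction n arbitrary: f)
  case 0
  then show ?case by (simp add: continuous_on_inner)
next
  case (Suc n)
  then show ?case
    using Suc.prems
    by (auto simp: frechet_derivative_inner_left(1)
        intro!: Ck_on_cong[OF assms(1) frechet_derivative_inner_left(2)[symmetric] Suc.IH])
qed

text \<open>Pairing with a fixed vector \<open>w\<close> commutes with differentiation and reduces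
  the claim to real functions; a vector is determined by its inner products with all
  \<open>w\<close>.\<close>

lemma second_derivative_symmetric:
  fixes f :: "'a::real_normed_vector \<Rightarrow> 'b::real_inner"
  assumes "open S" "Ck_on (Suc (Suc 0)) S f" "x \<in> S"
  shows "frechet_derivative (\<lambda>y. frechet_derivative f (at y) u) (at x) v =
    frechet_derivative (\<lambda>y. frechet_derivative f (at y) v) (at x) u"
proof -
  let ?D = "\<lambda>u v. frechet_derivative (\<lambda>y. frechet_derivative f (at y) u) (at x) v"
  have "frechet_derivative (\<lambda>y. frechet_derivative (\<lambda>y. f y \<bullet> w) (at y) u) (at x) v = ?D u v \<bullet> w"
    for u v w
  proof -
    have d: "(\<lambda>y. frechet_derivative f (at y) u) differentiable at x" using assms by auto
    have "((\<lambda>y. frechet_derivative f (at y) u \<bullet> w) has_derivative (\<lambda>v. ?D u v \<bullet> w)) (at x)"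
      using d by (auto simp: frechet_derivative_works intro: has_derivative_inner_left)
    then have "((\<lambda>y. frechet_derivative (\<lambda>y. f y \<bullet> w) (at y) u) has_derivative (\<lambda>v. ?D u v \<bullet> w)) (at x)"
      using assms
      by (rule_tac has_derivative_transform_within_open[of _ _ x UNIV S])
         (auto simp: frechet_derivative_inner_left(2))
    from frechet_derivative_at[OF this] show ?thesis by metis
  qed
  then have "?D u v \<bullet> w = ?D v u \<bullet> w" for w
    using second_derivative_symmetric_real[OF assms(1) Ck_on_inner_left[OF assms(1,2)] assms(3), of w u v]
    by simp
  then show ?thesis by (metis vector_eq_rdot)
qed

section \<open>The Hopf vector field\<close>

text \<open>In finite dimension bilinearity already gives boundedness, and with it the product rule
  for \<open>ip22\<close>.\<close>

lemma bounded_bilinear_ip22: "bounded_bilinear ip22"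
  unfolding bilinear_conv_bounded_bilinear[symmetric] bilinear_def
  by (auto intro!: linearI simp: ip22_def algebra_simps)

lemmas ip22_linear = bounded_bilinear.add_left[OF bounded_bilinear_ip22]
  bounded_bilinear.add_right[OF bounded_bilinear_ip22]
  bounded_bilinear.diff_left[OF bounded_bilinear_ip22]
  bounded_bilinear.diff_right[OF bounded_bilinear_ip22]
  bounded_bilinear.scaleR_left[OF bounded_bilinear_ip22]
  bounded_bilinear.scaleR_right[OF bounded_bilinear_ip22]

lemma ip22_commute: "ip22 x y = ip22 y x"
  by (simp add: ip22_def algebra_simps)

lemma hopf_field_nth [simp]:
  "hopf_field \<kappa> q $ 1 = sqrt \<kappa> / 2 * - q$2" "hopf_field \<kappa> q $ 2 = sqrt \<kappa> / 2 * q$1"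
  "hopf_field \<kappa> q $ 3 = sqrt \<kappa> / 2 * - q$4" "hopf_field \<kappa> q $ 4 = sqrt \<kappa> / 2 * q$3"
  by (simp_all add: hopf_field_def)

lemma bounded_linear_hopf_field: "bounded_linear (hopf_field \<kappa>)"
  unfolding linear_conv_bounded_linear[symmetric]
  by (auto intro!: linearI simp: vec_eq_iff forall_4 algebra_simps)

text \<open>The field is \<open>sqrt \<kappa> / 2\<close> times multiplication by the imaginary unit
  in both complex coordinates, hence generates a circle action by isometries of
  \<open>ip22\<close>.\<close>

lemma ip22_hopf_field_skew: "ip22 (hopf_field \<kappa> x) y = - ip22 x (hopf_field \<kappa> y)"
  by (simp add: ip22_def algebra_simps)

lemma ip22_hopf_field_self: "ip22 x (hopf_field \<kappa> x) = 0"
  by (simp add: ip22_def)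

text \<open>Multiplication by the imaginary unit preserves \<open>ip22\<close>, so the value is the
  squared scaling factor \<open>\<kappa> / 4\<close> times \<open>- 4 / \<kappa>\<close>.\<close>

lemma ip22_hopf_field_hopf_field:
  assumes "\<kappa> > 0" "q \<in> ads \<kappa>"
  shows "ip22 (hopf_field \<kappa> q) (hopf_field \<kappa> q) = -1"
proof -
  have "ip22 (vector [- q$2, q$1, - q$4, q$3]) (vector [- q$2, q$1, - q$4, q$3]) = ip22 q q"
    by (simp add: ip22_def)
  then have "ip22 (hopf_field \<kappa> q) (hopf_field \<kappa> q) = (sqrt \<kappa> / 2)\<^sup>2 * ip22 q q"
    unfolding hopf_field_def ip22_linear power2_eq_square by (simp only: mult.assoc real_scaleR_def)
  then show ?thesis using assms by (simp add: ads_def power_divide)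
qed

lemma berger_hopf_field:
  assumes "\<kappa> > 0" "q \<in> ads \<kappa>"
  shows "berger \<kappa> \<tau> q X (hopf_field \<kappa> q) = \<tau>\<^sup>2 * ip22 X (hopf_field \<kappa> q)"
  by (simp add: berger_def ip22_hopf_field_hopf_field[OF assms] algebra_simps)

lemma berger_E1:
  assumes "\<kappa> > 0" "\<tau> > 0" "q \<in> ads \<kappa>"
  shows "berger \<kappa> \<tau> q X (E1 \<kappa> \<tau> q) = \<tau> * ip22 X (hopf_field \<kappa> q)"
    and "berger \<kappa> \<tau> q (E1 \<kappa> \<tau> q) (E1 \<kappa> \<tau> q) = -1"
proof -
  show *: "berger \<kappa> \<tau> q X (E1 \<kappa> \<tau> q) = \<tau> * ip22 X (hopf_field \<kappa> q)" for X
    using berger_hopf_field[OF assms(1,3), of \<tau> X] assms(2)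
    by (simp add: E1_def berger_def ip22_linear power2_eq_square field_simps)
  show "berger \<kappa> \<tau> q (E1 \<kappa> \<tau> q) (E1 \<kappa> \<tau> q) = -1"
    unfolding * using assms by (simp add: E1_def ip22_linear ip22_hopf_field_hopf_field)
qed

lemma bounded_linear_E1: "bounded_linear (E1 \<kappa> \<tau>)"
proof -
  have "E1 \<kappa> \<tau> = (\<lambda>q. (1 / \<tau>) *\<^sub>R hopf_field \<kappa> q)"
    by (simp add: E1_def fun_eq_iff)
  then show ?thesis
    by (simp add: bounded_linear_hopf_field bounded_linear_const_scaleR)
qed

text \<open>The field is linear, skew for \<open>ip22\<close> and a multiple of the Hopf field, so
  its flow preserves both ingredients of the metric. Infinitesimally: by the product rule the
  derivatives of \<open>X\<close> and \<open>Y\<close> match on both sides, and the remaining terms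
  agree by skewness.\<close>

lemma killing_field_E1: "killing_field \<kappa> \<tau> (E1 \<kappa> \<tau>)"
proof -
  have "E1 \<kappa> \<tau> q \<in> tangent_ads q" for q
    by (simp add: tangent_ads_def E1_def ip22_linear ip22_hopf_field_self)
  then have vf: "vector_field_ads \<kappa> (E1 \<kappa> \<tau>)"
    by (simp add: vector_field_ads_def bounded_linear_imp_smooth_on bounded_linear_E1)
  have "frechet_derivative (\<lambda>p. berger \<kappa> \<tau> p (X p) (Y p)) (at q) (E1 \<kappa> \<tau> q)
      = berger \<kappa> \<tau> q (lie_bracket (E1 \<kappa> \<tau>) X q) (Y q)
        + berger \<kappa> \<tau> q (X q) (lie_bracket (E1 \<kappa> \<tau>) Y q)"
    if X: "vector_field_ads \<kappa> X" and Y: "vector_field_ads \<kappa> Y" for X Y q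
  proof -
    let ?H = "hopf_field \<kappa>" and ?V = "E1 \<kappa> \<tau> q"
    define DX where "DX = frechet_derivative X (at q)"
    define DY where "DY = frechet_derivative Y (at q)"
    have "Ck_on (Suc 0) UNIV X" "Ck_on (Suc 0) UNIV Y"
      using X Y by (auto simp: vector_field_ads_def smooth_on_def simp del: Ck_on.simps)
    then have D: "(X has_derivative DX) (at q)" "(Y has_derivative DY) (at q)"
      by (simp_all add: DX_def DY_def frechet_derivative_works[symmetric])
    \<comment> \<open>A bounded linear map is its own derivative, so the bracket with
      \<open>X\<close> becomes \<open>DX ?V - E1 \<kappa> \<tau> (X q)\<close>.\<close>
    have DE: "frechet_derivative (E1 \<kappa> \<tau>) (at q) = E1 \<kappa> \<tau>"
      by (metis frechet_derivative_at bounded_linear_imp_has_derivative bounded_linear_E1)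
    have DH: "(?H has_derivative ?H) (at q)"
      by (rule bounded_linear_imp_has_derivative[OF bounded_linear_hopf_field])
    note FD = bounded_bilinear.FDERIV[OF bounded_bilinear_ip22]
    have "((\<lambda>p. ip22 (X p) (Y p) + (1 - \<tau>\<^sup>2) * (ip22 (X p) (?H p) * ip22 (Y p) (?H p)))
      has_derivative (\<lambda>v. (ip22 (X q) (DY v) + ip22 (DX v) (Y q)) +
        (1 - \<tau>\<^sup>2) * (ip22 (X q) (?H q) * (ip22 (Y q) (?H v) + ip22 (DY v) (?H q))
          + (ip22 (X q) (?H v) + ip22 (DX v) (?H q)) * ip22 (Y q) (?H q)))) (at q)"
      by (intro has_derivative_add has_derivative_mult_right has_derivative_mult FD D DH)
    then have "frechet_derivative (\<lambda>p. berger \<kappa> \<tau> p (X p) (Y p)) (at q) ?V =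
      (ip22 (X q) (DY ?V) + ip22 (DX ?V) (Y q)) +
        (1 - \<tau>\<^sup>2) * (ip22 (X q) (?H q) * (ip22 (Y q) (?H ?V) + ip22 (DY ?V) (?H q))
          + (ip22 (X q) (?H ?V) + ip22 (DX ?V) (?H q)) * ip22 (Y q) (?H q))"
      unfolding berger_def by (subst frechet_derivative_at[symmetric]) (auto simp: mult.assoc)
    also have "\<dots> = berger \<kappa> \<tau> q (DX ?V - E1 \<kappa> \<tau> (X q)) (Y q)
        + berger \<kappa> \<tau> q (X q) (DY ?V - E1 \<kappa> \<tau> (Y q))"
    proof -
      have "?H ?V = (1 / \<tau>) *\<^sub>R ?H (?H q)"
        unfolding E1_def by (rule linear_cmul[OF bounded_linear.linear[OF bounded_linear_hopf_field]])
      then show ?thesis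
        by (simp add: berger_def E1_def ip22_linear ip22_hopf_field_skew algebra_simps
            add_divide_distrib diff_divide_distrib)
    qed
    finally show ?thesis
      by (simp add: lie_bracket_def DE DX_def DY_def)
  qed
  with vf show ?thesis by (simp add: killing_field_def)
qed

text \<open>With \<open>z\<close> and \<open>w\<close> the complex coordinates, the real and
  imaginary parts of \<open>z * cnj w\<close> and the square of \<open>cmod w\<close> are constant
  along the fiber. Their derivatives vanish, and as \<open>w\<close> is nonzero this leaves only the
  direction of the circle action.\<close>

lemma hopf_fiber_velocity:
  assumes "\<kappa> > 0" "q \<in> ads \<kappa>" "range \<delta> \<subseteq> hopf_fiber \<kappa> q" "\<delta> 0 = q"
    and v: "(\<delta> has_vector_derivative v) (at 0)"
  obtains m where "v = m *\<^sub>R hopf_field \<kappa> q"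
proof -
  have D: "((\<lambda>t. \<delta> t $ i) has_real_derivative v $ i) (at 0)" for i
    using bounded_linear.has_vector_derivative[OF bounded_linear_vec_nth v, of i]
    by (simp add: has_real_derivative_iff_has_vector_derivative)
  have fib: "\<delta> t \<in> ads \<kappa>" "hopf_map \<kappa> (\<delta> t) = hopf_map \<kappa> q" for t
    using assms(3) by (auto simp: hopf_fiber_def)
  \<comment> \<open>The Hopf map fixes the sum of the squared moduli of \<open>z\<close> and
    \<open>w\<close>, the equation of \<open>ads \<kappa>\<close> fixes their difference; together
    they fix each of them.\<close>
  have c: "(\<delta> t$3)\<^sup>2 + (\<delta> t$4)\<^sup>2 = (q$3)\<^sup>2 + (q$4)\<^sup>2"
    "\<delta> t$1 * \<delta> t$3 + \<delta> t$2 * \<delta> t$4 = q$1 * q$3 + q$2 * q$4"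
    "\<delta> t$2 * \<delta> t$3 - \<delta> t$1 * \<delta> t$4 = q$2 * q$3 - q$1 * q$4" for t
  proof -
    have "sqrt \<kappa> / 4 \<noteq> 0" using assms(1) by simp
    then have "2 * Complex (\<delta> t$1) (\<delta> t$2) * cnj (Complex (\<delta> t$3) (\<delta> t$4))
          = 2 * Complex (q$1) (q$2) * cnj (Complex (q$3) (q$4))"
      and sum: "(\<delta> t$1)\<^sup>2 + (\<delta> t$2)\<^sup>2 + ((\<delta> t$3)\<^sup>2 + (\<delta> t$4)\<^sup>2)
          = (q$1)\<^sup>2 + (q$2)\<^sup>2 + ((q$3)\<^sup>2 + (q$4)\<^sup>2)"
      using fib(2)[of t] unfolding hopf_map_def Let_def scaleR_cancel_left
      by (simp_all add: cmod_power2)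
    then show "\<delta> t$1 * \<delta> t$3 + \<delta> t$2 * \<delta> t$4 = q$1 * q$3 + q$2 * q$4"
      "\<delta> t$2 * \<delta> t$3 - \<delta> t$1 * \<delta> t$4 = q$2 * q$3 - q$1 * q$4"
      by (simp_all add: complex_eq_iff)
    have "(\<delta> t$1)\<^sup>2 + (\<delta> t$2)\<^sup>2 - ((\<delta> t$3)\<^sup>2 + (\<delta> t$4)\<^sup>2)
        = (q$1)\<^sup>2 + (q$2)\<^sup>2 - ((q$3)\<^sup>2 + (q$4)\<^sup>2)"
      using fib(1)[of t] assms(2) by (simp add: ads_def ip22_def power2_eq_square)
    with sum show "(\<delta> t$3)\<^sup>2 + (\<delta> t$4)\<^sup>2 = (q$3)\<^sup>2 + (q$4)\<^sup>2" by linarith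
  qed
  have "((\<lambda>t. (\<delta> t$3)\<^sup>2 + (\<delta> t$4)\<^sup>2) has_real_derivative 2 * q$3 * v$3 + 2 * q$4 * v$4) (at 0)"
    by (auto intro!: derivative_eq_intros D simp: assms(4))
  then have e1: "q$3 * v$3 + q$4 * v$4 = 0"
    unfolding c using DERIV_unique[OF _ DERIV_const] by fastforce
  have "((\<lambda>t. \<delta> t$1 * \<delta> t$3 + \<delta> t$2 * \<delta> t$4) has_real_derivative
      v$1 * q$3 + q$1 * v$3 + v$2 * q$4 + q$2 * v$4) (at 0)"
    by (auto intro!: derivative_eq_intros D simp: assms(4))
  then have e2: "v$1 * q$3 + q$1 * v$3 + v$2 * q$4 + q$2 * v$4 = 0"
    unfolding c using DERIV_unique[OF _ DERIV_const] by blast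
  have "((\<lambda>t. \<delta> t$2 * \<delta> t$3 - \<delta> t$1 * \<delta> t$4) has_real_derivative
      v$2 * q$3 + q$2 * v$3 - (v$1 * q$4 + q$1 * v$4)) (at 0)"
    by (auto intro!: derivative_eq_intros D simp: assms(4))
  then have e3: "v$2 * q$3 + q$2 * v$3 - (v$1 * q$4 + q$1 * v$4) = 0"
    unfolding c using DERIV_unique[OF _ DERIV_const] by blast
  define R where "R = (q$3)\<^sup>2 + (q$4)\<^sup>2"
  have "R = (q$1)\<^sup>2 + (q$2)\<^sup>2 + 4 / \<kappa>"
    using assms(2) by (simp add: R_def ads_def ip22_def power2_eq_square)
  then have "R > 0" using assms(1) by (smt (verit) divide_pos_pos zero_le_power2)
  \<comment> \<open>The angular speed of \<open>w\<close>: by \<open>e1\<close> the product of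
    \<open>cnj w\<close> with the velocity of \<open>w\<close> is purely imaginary, and
    \<open>s * R\<close> is its imaginary part.\<close>
  define s where "s = (q$3 * v$4 - q$4 * v$3) / R"
  have sR: "s * R = q$3 * v$4 - q$4 * v$3" using \<open>R > 0\<close> by (simp add: s_def)
  have "v$3 * R = (- s * q$4) * R"
    using e1 sR R_def by algebra
  moreover have "v$4 * R = (s * q$3) * R"
    using e1 sR R_def by algebra
  ultimately have v34: "v$3 = - s * q$4" "v$4 = s * q$3"
    using \<open>R > 0\<close> unfolding mult_cancel_right by auto
  \<comment> \<open>Given that \<open>w\<close> rotates with speed \<open>s\<close>,
    \<open>e2\<close> and \<open>e3\<close> say that \<open>z * cnj w\<close> is stationary;
    cancelling \<open>cnj w\<close> shows that \<open>z\<close> rotates with the same speed.\<close>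
  have "v$1 * R = (- s * q$2) * R"
    using e2 e3 v34 R_def by algebra
  moreover have "v$2 * R = (s * q$1) * R"
    using e2 e3 v34 R_def by algebra
  ultimately have v12: "v$1 = - s * q$2" "v$2 = s * q$1"
    using \<open>R > 0\<close> unfolding mult_cancel_right by auto
  have "v = (2 * s / sqrt \<kappa>) *\<^sub>R hopf_field \<kappa> q"
    using assms(1) by (simp add: vec_eq_iff forall_4 v12 v34)
  then show thesis by (rule that)
qed


section \<open>Helices from constant inner products\<close>

lemma berger_scaleR:
  "berger \<kappa> \<tau> q X (c *\<^sub>R Y) = c * berger \<kappa> \<tau> q X Y"
  "berger \<kappa> \<tau> q (c *\<^sub>R X) Y = c * berger \<kappa> \<tau> q X Y"
  by (simp_all add: berger_def ip22_linear algebra_simps)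

lemma berger_commute: "berger \<kappa> \<tau> q X Y = berger \<kappa> \<tau> q Y X"
  by (simp add: berger_def ip22_commute mult_ac)

text \<open>The part of the argument common to the three kinds of curves. The squared speed
  simplifies because \<open>helix_B \<tau> lam \<nu> + (1 - \<tau>\<^sup>2) * (lam +
  \<nu>\<^sup>2)\<close> equals \<open>- lam * \<tau>\<^sup>2\<close>.\<close>

lemma helix_if_constant_products:
  fixes \<gamma> :: "real \<Rightarrow> real^4"
  assumes \<kappa>: "\<kappa> > 0" and \<tau>: "\<tau> > 0" and lam: "lam \<in> {-1, 1}" and pos: "lam + \<nu>\<^sup>2 > 0"
    and c: "curve_ads \<kappa> \<gamma>"
    and vv: "\<And>x. ip22 (velocity \<gamma> x) (velocity \<gamma> x) = (lam + \<nu>\<^sup>2) * helix_B \<tau> lam \<nu> / \<tau>\<^sup>2"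
    and vh: "\<And>x. ip22 (velocity \<gamma> x) (hopf_field \<kappa> (\<gamma> x)) = - lam * (lam + \<nu>\<^sup>2) / \<tau>"
  shows "(lam = -1 \<longrightarrow> spacelike_curve \<kappa> \<tau> \<gamma>) \<and>
         (lam = 1 \<longrightarrow> timelike_curve \<kappa> \<tau> \<gamma>) \<and>
         general_helix_with_axis \<kappa> \<tau> (E1 \<kappa> \<tau>) \<gamma> \<and>
         meets_hopf_fibers_at_constant_angle \<kappa> \<tau> \<gamma> \<and>
         (\<forall>x. angle_function \<kappa> \<tau> (E1 \<kappa> \<tau>) \<gamma> x = - lam * sqrt (lam + \<nu>\<^sup>2))"
proof -
  define r where "r = lam + \<nu>\<^sup>2"
  have r: "r > 0" using pos by (simp add: r_def)
  have ads: "\<gamma> x \<in> ads \<kappa>" for x using c by (auto simp: curve_ads_def)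
  have lam2: "lam * lam = 1" using lam by auto
  have speed: "berger \<kappa> \<tau> (\<gamma> x) (velocity \<gamma> x) (velocity \<gamma> x) = - lam * r" for x
  proof -
    have "\<tau>\<^sup>2 * berger \<kappa> \<tau> (\<gamma> x) (velocity \<gamma> x) (velocity \<gamma> x)
      = r * helix_B \<tau> lam \<nu> + (1 - \<tau>\<^sup>2) * (lam * lam) * r\<^sup>2"
      unfolding berger_def vv vh using \<tau> by (simp add: r_def field_simps power2_eq_square)
    also have "\<dots> = \<tau>\<^sup>2 * (- lam * r)"
      unfolding lam2 helix_B_def r_def by algebra
    finally show ?thesis using \<tau> mult_left_cancel[of "\<tau>\<^sup>2"] by fastforce
  qed
  have norm: "berger_norm \<kappa> \<tau> (\<gamma> x) (velocity \<gamma> x) = sqrt r" for x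
    using lam r by (auto simp: berger_norm_def speed)
  have div: "r / sqrt r = sqrt r" using r by (simp add: real_div_sqrt)
  have angle: "angle_function \<kappa> \<tau> (E1 \<kappa> \<tau>) \<gamma> x = - lam * sqrt r" for x
  proof -
    have "angle_function \<kappa> \<tau> (E1 \<kappa> \<tau>) \<gamma> x = - lam * (r / sqrt r)"
      unfolding angle_function_def berger_E1[OF \<kappa> \<tau> ads] norm vh using \<tau> by (simp add: r_def)
    then show ?thesis by (simp add: div)
  qed
  have sl: "lam = -1 \<longrightarrow> spacelike_curve \<kappa> \<tau> \<gamma>" "lam = 1 \<longrightarrow> timelike_curve \<kappa> \<tau> \<gamma>"
    using c r by (auto simp: spacelike_curve_def timelike_curve_def speed)
  have "non_null_curve \<kappa> \<tau> \<gamma>"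
    using c r lam by (auto simp: non_null_curve_def speed)
  moreover have "berger_norm \<kappa> \<tau> (\<gamma> x) (E1 \<kappa> \<tau> (\<gamma> x)) = 1" for x
    by (simp add: berger_norm_def berger_E1(2)[OF \<kappa> \<tau> ads])
  moreover have "- lam * sqrt r \<noteq> 0" using lam r by auto
  ultimately have helix: "general_helix_with_axis \<kappa> \<tau> (E1 \<kappa> \<tau>) \<gamma>"
    unfolding general_helix_with_axis_def using killing_field_E1 angle by blast
  have "meets_hopf_fibers_at_constant_angle \<kappa> \<tau> \<gamma>"
    unfolding meets_hopf_fibers_at_constant_angle_def
  \<comment> \<open>The witness is the absolute value of the angle function with \<open>E1\<close>:
    the scale \<open>m\<close> of the fiber velocity cancels in the quotient.\<close>
  proof (intro exI[of _ "sqrt r"] allI impI)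
    fix x \<delta> v
    assume "range \<delta> \<subseteq> hopf_fiber \<kappa> (\<gamma> x)" "\<delta> 0 = \<gamma> x"
      "(\<delta> has_vector_derivative v) (at 0)" and "v \<noteq> 0"
    then obtain m where m: "v = m *\<^sub>R hopf_field \<kappa> (\<gamma> x)"
      using hopf_fiber_velocity[OF \<kappa> ads] by metis
    with \<open>v \<noteq> 0\<close> have "m \<noteq> 0" by auto
    have "berger \<kappa> \<tau> (\<gamma> x) v v = - (m * \<tau>)\<^sup>2"
      by (simp add: m berger_scaleR berger_hopf_field[OF \<kappa> ads] ip22_hopf_field_hopf_field[OF \<kappa> ads]
          power2_eq_square)
    then have "berger_norm \<kappa> \<tau> (\<gamma> x) v = \<bar>m\<bar> * \<tau>"
      using \<tau> by (simp add: berger_norm_def abs_mult)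
    moreover have "berger \<kappa> \<tau> (\<gamma> x) (velocity \<gamma> x) v = - (m * \<tau> * lam * r)"
      using \<tau> by (simp add: m berger_scaleR berger_hopf_field[OF \<kappa> ads] vh power2_eq_square r_def)
    then have "\<bar>berger \<kappa> \<tau> (\<gamma> x) (velocity \<gamma> x) v\<bar> = \<bar>m\<bar> * \<tau> * r"
      using \<tau> r lam by (auto simp: abs_mult)
    ultimately show "\<bar>berger \<kappa> \<tau> (\<gamma> x) (velocity \<gamma> x) v\<bar>
        / (berger_norm \<kappa> \<tau> (\<gamma> x) (velocity \<gamma> x) * berger_norm \<kappa> \<tau> (\<gamma> x) v) = sqrt r"
      using \<tau> \<open>m \<noteq> 0\<close> r by (simp add: norm div)
  qed
  with sl helix angle show ?thesis by (simp add: r_def)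
qed

section \<open>The three families of associated curves\<close>

text \<open>Two circular motions of radii \<open>p\<close> and \<open>q\<close> and speeds
  \<open>a1\<close> and \<open>a2\<close>, in opposite senses. As \<open>p\<^sup>2 = c * a2\<close>
  and \<open>q\<^sup>2 = c * a1\<close>, all the products are expressed by \<open>c\<close>,
  \<open>a1 * a2\<close> and \<open>a1 - a2\<close>, which have simple closed forms.\<close>

lemma curve_pos_products:
  assumes \<kappa>: "\<kappa> > 0" and \<tau>: "\<tau> > 0" and lam: "lam \<in> {-1, 1}" and pos: "lam + \<nu>\<^sup>2 > 0"
    and "\<nu> \<noteq> 0" and B: "helix_B \<tau> lam \<nu> > 0"
  defines "\<gamma> \<equiv> curve_pos \<kappa> \<tau> lam \<nu>"
  shows "curve_ads \<kappa> \<gamma>"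
    and "ip22 (velocity \<gamma> x) (velocity \<gamma> x) = (lam + \<nu>\<^sup>2) * helix_B \<tau> lam \<nu> / \<tau>\<^sup>2"
    and "ip22 (velocity \<gamma> x) (hopf_field \<kappa> (\<gamma> x)) = - lam * (lam + \<nu>\<^sup>2) / \<tau>"
proof -
  define b where "b = helix_B \<tau> lam \<nu>"
  define r where "r = lam + \<nu>\<^sup>2"
  define k where "k = sqrt \<kappa>"
  define a1 where "a1 = k / 2 * (\<bar>\<nu>\<bar> * sqrt b + b / \<tau>)"
  define a2 where "a2 = k / 2 * (\<bar>\<nu>\<bar> * sqrt b - b / \<tau>)"
  define c where "c = 4 * \<tau> / (\<kappa> powr (3/2) * b)"
  define p where "p = sqrt (c * a2)"
  define q where "q = sqrt (c * a1)"
  have b: "b > 0" and r: "r > 0" and k: "k > 0" "k * k = \<kappa>" and lam2: "lam\<^sup>2 = 1"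
    using B pos \<kappa> lam by (auto simp: b_def r_def k_def)
  have br: "b + r = \<tau>\<^sup>2 * \<nu>\<^sup>2"
    by (simp add: b_def r_def helix_B_def algebra_simps)
  have "\<kappa> powr (3/2) = \<kappa> powr 1 * \<kappa> powr (1/2)"
    unfolding powr_add[symmetric] by simp
  then have c: "c = 4 * \<tau> / (k * k * k * b)" and "c > 0"
    using \<kappa> \<tau> b k by (simp_all add: c_def powr_half_sqrt k_def)
  have "a1 * a2 = k * k / 4 * (\<bar>\<nu>\<bar>\<^sup>2 * (sqrt b)\<^sup>2 - b\<^sup>2 / \<tau>\<^sup>2)"
    unfolding a1_def a2_def using \<tau> by (simp add: field_simps power2_eq_square)
  also have "\<dots> = k * k / 4 * (b / \<tau>\<^sup>2 * (\<tau>\<^sup>2 * \<nu>\<^sup>2 - b))"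
    using \<tau> b by (simp add: field_simps power2_eq_square)
  finally have a12: "a1 * a2 = k * k * b * r / (4 * \<tau>\<^sup>2)"
    unfolding br[symmetric] by simp
  have diff: "a1 - a2 = k * b / \<tau>"
    by (simp add: a1_def a2_def algebra_simps)
  have "a1 > 0"
    using k b \<tau> \<open>\<nu> \<noteq> 0\<close> unfolding a1_def by (simp add: add_pos_pos)
  moreover have "a1 * a2 > 0"
    unfolding a12 using k b r \<tau> \<kappa> by simp
  \<comment> \<open>As a difference, \<open>a2\<close> does not show its sign; it is positive
    because \<open>a1\<close> and the product are, the latter thanks to \<open>r > 0\<close>. Hence
    the radicand in \<open>p\<close> is positive.\<close>
  ultimately have "a2 > 0" by (simp add: zero_less_mult_iff)
  then have pq: "p\<^sup>2 = c * a2" "q\<^sup>2 = c * a1"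
    using \<open>a1 > 0\<close> \<open>c > 0\<close> by (simp_all add: p_def q_def)
  have caa: "c * (a1 * a2) = r / (k * \<tau>)"
    unfolding a12 c using k \<kappa> b \<tau> by (simp add: field_simps power2_eq_square)
  have \<gamma>: "\<gamma> = (\<lambda>x. vector [p * cos (a1 * x), - lam * p * sin (a1 * x),
      q * cos (a2 * x), lam * q * sin (a2 * x)])"
    unfolding \<gamma>_def curve_pos_def Let_def p_def q_def a1_def a2_def c_def b_def k_def
    by (rule ext) (simp only: mult_minus_left minus_minus)
  have vel: "velocity \<gamma> x = vector [p * (- a1 * sin (a1 * x)), - lam * p * (a1 * cos (a1 * x)),
      q * (- a2 * sin (a2 * x)), lam * q * (a2 * cos (a2 * x))]" for x
    unfolding velocity_def \<gamma>
    by (intro vector_derivative_at has_vector_derivative_vector4) (auto intro!: derivative_eq_intros)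
  note trig = sin_cos_squared_add[of "a1 * x" for x] sin_cos_squared_add[of "a2 * x" for x]
  have "\<gamma> x \<in> ads \<kappa>" for x
  proof -
    have "ip22 (\<gamma> x) (\<gamma> x) = p\<^sup>2 - q\<^sup>2"
      unfolding ip22_def \<gamma> vector_4_nth using trig[of x] lam2 by algebra
    also have "\<dots> = - c * (a1 - a2)" unfolding pq by algebra
    also have "\<dots> = - 4 / \<kappa>"
      unfolding diff c k(2)[symmetric] using k(1) b \<tau> by (simp add: field_simps)
    finally show ?thesis by (simp add: ads_def)
  qed
  then show "curve_ads \<kappa> \<gamma>"
    unfolding curve_ads_def \<gamma> by (auto intro!: smooth_on_vector4 elementary.intros elementary_uminus)
  have "ip22 (velocity \<gamma> x) (velocity \<gamma> x) = p\<^sup>2 * a1\<^sup>2 - q\<^sup>2 * a2\<^sup>2"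
    unfolding ip22_def vel vector_4_nth using trig[of x] lam2 by algebra
  also have "\<dots> = c * (a1 * a2) * (a1 - a2)" unfolding pq by algebra
  also have "\<dots> = r * b / \<tau>\<^sup>2"
    unfolding caa diff using k \<tau> by (simp add: field_simps power2_eq_square)
  finally show "ip22 (velocity \<gamma> x) (velocity \<gamma> x) = (lam + \<nu>\<^sup>2) * helix_B \<tau> lam \<nu> / \<tau>\<^sup>2"
    by (simp add: r_def b_def)
  have "ip22 (velocity \<gamma> x) (hopf_field \<kappa> (\<gamma> x)) = k / 2 * (- lam * (p\<^sup>2 * a1 + q\<^sup>2 * a2))"
  proof -
    have "ip22 (velocity \<gamma> x) (hopf_field \<kappa> (\<gamma> x)) = k / 2 *
       (velocity \<gamma> x $ 2 * \<gamma> x $ 1 - velocity \<gamma> x $ 1 * \<gamma> x $ 2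
        - velocity \<gamma> x $ 4 * \<gamma> x $ 3 + velocity \<gamma> x $ 3 * \<gamma> x $ 4)"
      by (simp add: ip22_def k_def algebra_simps)
    also have "velocity \<gamma> x $ 2 * \<gamma> x $ 1 - velocity \<gamma> x $ 1 * \<gamma> x $ 2
        - velocity \<gamma> x $ 4 * \<gamma> x $ 3 + velocity \<gamma> x $ 3 * \<gamma> x $ 4 = - lam * (p\<^sup>2 * a1 + q\<^sup>2 * a2)"
      unfolding vel unfolding \<gamma> vector_4_nth using trig[of x] by algebra
    finally show ?thesis .
  qed
  also have "p\<^sup>2 * a1 + q\<^sup>2 * a2 = 2 * (c * (a1 * a2))" unfolding pq by algebra
  also have "k / 2 * (- lam * (2 * (c * (a1 * a2)))) = - lam * r / \<tau>"
    unfolding caa using k(1) by simp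
  finally show "ip22 (velocity \<gamma> x) (hopf_field \<kappa> (\<gamma> x)) = - lam * (lam + \<nu>\<^sup>2) / \<tau>"
    by (simp add: r_def)
qed

text \<open>The curve is a straight line of four-space whose direction is null and orthogonal to its
  starting point for \<open>ip22\<close>, so it stays in \<open>ads \<kappa>\<close>.\<close>

lemma curve_zero_products:
  assumes \<kappa>: "\<kappa> > 0" and \<tau>: "\<tau> > 0" and lam: "lam \<in> {-1, 1}" and B: "helix_B \<tau> lam \<nu> = 0"
  defines "\<gamma> \<equiv> curve_zero \<kappa> \<tau> lam \<nu>"
  shows "curve_ads \<kappa> \<gamma>"
    and "ip22 (velocity \<gamma> x) (velocity \<gamma> x) = (lam + \<nu>\<^sup>2) * helix_B \<tau> lam \<nu> / \<tau>\<^sup>2"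
    and "ip22 (velocity \<gamma> x) (hopf_field \<kappa> (\<gamma> x)) = - lam * (lam + \<nu>\<^sup>2) / \<tau>"
proof -
  have r: "lam + \<nu>\<^sup>2 = \<nu>\<^sup>2 * \<tau>\<^sup>2"
    using B by (simp add: helix_B_def algebra_simps)
  have lam2: "lam * lam = 1" using lam by auto
  have \<gamma>: "\<gamma> = (\<lambda>x. vector [\<nu>\<^sup>2 * \<tau> * x, 0, 2 / sqrt \<kappa>, \<nu>\<^sup>2 * \<tau> * lam * x])"
    by (simp add: fun_eq_iff \<gamma>_def curve_zero_def)
  have vel: "velocity \<gamma> x = vector [\<nu>\<^sup>2 * \<tau>, 0, 0, \<nu>\<^sup>2 * \<tau> * lam]" for x
    unfolding velocity_def \<gamma>
    by (intro vector_derivative_at has_vector_derivative_vector4) (auto intro!: derivative_eq_intros)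
  have "ip22 (\<gamma> x) (\<gamma> x) = - (2 / sqrt \<kappa>)\<^sup>2" for x
    unfolding ip22_def \<gamma> vector_4_nth using lam2 by algebra
  then have "\<gamma> x \<in> ads \<kappa>" for x
    using \<kappa> by (simp add: ads_def power_divide)
  then show "curve_ads \<kappa> \<gamma>"
    unfolding curve_ads_def \<gamma> by (auto intro!: smooth_on_vector4 elementary.intros)
  show "ip22 (velocity \<gamma> x) (velocity \<gamma> x) = (lam + \<nu>\<^sup>2) * helix_B \<tau> lam \<nu> / \<tau>\<^sup>2"
    using lam by (auto simp: B vel ip22_def)
  show "ip22 (velocity \<gamma> x) (hopf_field \<kappa> (\<gamma> x)) = - lam * (lam + \<nu>\<^sup>2) / \<tau>"
    unfolding r vel using \<kappa> \<tau> by (simp add: \<gamma> ip22_def power2_eq_square)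
qed

text \<open>In complex coordinates \<open>z = a * sinh (\<beta> * x)\<close> and
  \<open>w = b * cosh (\<beta> * x) + i * d * sinh (\<beta> * x)\<close>, both rotated by the angle
  \<open>\<alpha> * x\<close>. Two relations between the constants, \<open>abd\<close> and
  \<open>\<alpha>\<beta>\<close>, carry all three claims.\<close>

lemma curve_neg_products:
  assumes \<kappa>: "\<kappa> > 0" and \<tau>: "\<tau> > 0" and lam: "lam \<in> {-1, 1}" and pos: "lam + \<nu>\<^sup>2 > 0"
    and B: "helix_B \<tau> lam \<nu> < 0"
  defines "\<gamma> \<equiv> curve_neg \<kappa> \<tau> lam \<nu>"
  shows "curve_ads \<kappa> \<gamma>"
    and "ip22 (velocity \<gamma> x) (velocity \<gamma> x) = (lam + \<nu>\<^sup>2) * helix_B \<tau> lam \<nu> / \<tau>\<^sup>2"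
    and "ip22 (velocity \<gamma> x) (hopf_field \<kappa> (\<gamma> x)) = - lam * (lam + \<nu>\<^sup>2) / \<tau>"
proof -
  define e where "e = helix_B \<tau> lam \<nu>"
  define r where "r = lam + \<nu>\<^sup>2"
  define k where "k = sqrt \<kappa>"
  define D where "D = sqrt (- \<kappa> * e)"
  define \<alpha> where "\<alpha> = - (k / 2) * (e / (lam * \<tau>))"
  define \<beta> where "\<beta> = \<bar>\<nu>\<bar> * (D / 2)"
  define a where "a = 2 * sqrt r / D"
  define b where "b = 2 / k"
  define d where "d = 2 * lam * \<tau> * \<bar>\<nu>\<bar> / D"
  have r: "r > 0" and k: "k > 0" "k\<^sup>2 = \<kappa>" and lam2: "lam\<^sup>2 = 1"
    using pos \<kappa> lam by (auto simp: r_def k_def)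
  have "- \<kappa> * e > 0" using \<kappa> B by (simp add: e_def mult_less_0_iff)
  then have D: "D > 0" "D\<^sup>2 = - \<kappa> * e" by (simp_all add: D_def)
  have er: "r = \<tau>\<^sup>2 * \<nu>\<^sup>2 - e"
    by (simp add: e_def r_def helix_B_def algebra_simps)
  have bk: "b * k = 2" using k by (simp add: b_def)
  have b2: "b\<^sup>2 = 4 / \<kappa>" using k by (simp add: b_def power_divide)
  have "a\<^sup>2 = 4 * r / D\<^sup>2" using r by (simp add: a_def power_divide power_mult_distrib)
  moreover have "d\<^sup>2 = 4 * (\<tau>\<^sup>2 * \<nu>\<^sup>2) / D\<^sup>2"
    by (simp add: d_def power_divide power_mult_distrib lam2)
  moreover have "b\<^sup>2 = 4 * (- e) / D\<^sup>2"
    unfolding b2 D(2) using \<kappa> B by (simp add: e_def)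
  \<comment> \<open>Multiplied by \<open>D\<^sup>2 / 4\<close>, this is the relation
    \<open>er\<close>.\<close>
  ultimately have abd: "a\<^sup>2 = b\<^sup>2 + d\<^sup>2"
    by (simp add: er diff_divide_distrib algebra_simps)
  have a\<beta>: "a\<^sup>2 * \<beta>\<^sup>2 = r * \<nu>\<^sup>2"
    using r D(1) by (simp add: a_def \<beta>_def power_divide power_mult_distrib)
  have "\<alpha> * b = - (e / (lam * \<tau>))" using k by (simp add: \<alpha>_def b_def)
  also have "\<dots> = - lam * e / \<tau>" using lam by auto
  also have "d * \<beta> = lam * \<tau> * \<nu>\<^sup>2"
    using D(1) by (simp add: d_def \<beta>_def power2_eq_square)
  then have "- lam * e / \<tau> = lam * r / \<tau> - d * \<beta>"
    unfolding er using \<tau> by (simp add: field_simps power2_eq_square)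
  finally have \<alpha>\<beta>: "\<alpha> * b + d * \<beta> = lam * r / \<tau>" by simp
  have \<gamma>: "\<gamma> = (\<lambda>x. vector [a * cos (\<alpha> * x) * sinh (\<beta> * x), a * sin (\<alpha> * x) * sinh (\<beta> * x),
      b * cos (\<alpha> * x) * cosh (\<beta> * x) - d * sin (\<alpha> * x) * sinh (\<beta> * x),
      b * sin (\<alpha> * x) * cosh (\<beta> * x) + d * cos (\<alpha> * x) * sinh (\<beta> * x)])"
    by (simp add: fun_eq_iff \<gamma>_def curve_neg_def Let_def \<alpha>_def \<beta>_def a_def b_def d_def e_def r_def
        k_def D_def)
  have vel: "velocity \<gamma> x = vector
     [a * (- \<alpha> * sin (\<alpha> * x) * sinh (\<beta> * x) + \<beta> * cos (\<alpha> * x) * cosh (\<beta> * x)),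
      a * (\<alpha> * cos (\<alpha> * x) * sinh (\<beta> * x) + \<beta> * sin (\<alpha> * x) * cosh (\<beta> * x)),
      b * (- \<alpha> * sin (\<alpha> * x) * cosh (\<beta> * x) + \<beta> * cos (\<alpha> * x) * sinh (\<beta> * x))
        - d * (\<alpha> * cos (\<alpha> * x) * sinh (\<beta> * x) + \<beta> * sin (\<alpha> * x) * cosh (\<beta> * x)),
      b * (\<alpha> * cos (\<alpha> * x) * cosh (\<beta> * x) + \<beta> * sin (\<alpha> * x) * sinh (\<beta> * x))
        + d * (- \<alpha> * sin (\<alpha> * x) * sinh (\<beta> * x) + \<beta> * cos (\<alpha> * x) * cosh (\<beta> * x))]" for x
    unfolding velocity_def \<gamma>
    by (intro vector_derivative_at has_vector_derivative_vector4)
       (auto intro!: derivative_eq_intros simp: algebra_simps)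
  have trig: "(sin (\<alpha> * x))\<^sup>2 + (cos (\<alpha> * x))\<^sup>2 = 1" "(cosh (\<beta> * x))\<^sup>2 = (sinh (\<beta> * x))\<^sup>2 + 1" for x
    using cosh_square_eq by auto
  have "\<gamma> x \<in> ads \<kappa>" for x
  proof -
    have "ip22 (\<gamma> x) (\<gamma> x) = (a\<^sup>2 - d\<^sup>2) * (sinh (\<beta> * x))\<^sup>2 - b\<^sup>2 * (cosh (\<beta> * x))\<^sup>2"
      unfolding ip22_def \<gamma> vector_4_nth using trig(1)[of x] by algebra
    also have "\<dots> = - b\<^sup>2" unfolding abd trig(2) by algebra
    finally show ?thesis by (simp add: ads_def b2)
  qed
  then show "curve_ads \<kappa> \<gamma>"
    unfolding curve_ads_def \<gamma> by (auto intro!: smooth_on_vector4 elementary.intros elementary_diff)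
  have "ip22 (velocity \<gamma> x) (velocity \<gamma> x) =
      (a\<^sup>2 * \<alpha>\<^sup>2 - (b * \<beta> - d * \<alpha>)\<^sup>2) * (sinh (\<beta> * x))\<^sup>2
      + (a\<^sup>2 * \<beta>\<^sup>2 - (\<alpha> * b + d * \<beta>)\<^sup>2) * (cosh (\<beta> * x))\<^sup>2"
    unfolding ip22_def vel vector_4_nth using trig(1)[of x] by algebra
  \<comment> \<open>By \<open>abd\<close> the coefficients of the squared \<open>sinh\<close> and
    \<open>cosh\<close> are opposite to each other, so only the coefficient of the latter
    remains.\<close>
  also have "\<dots> = a\<^sup>2 * \<beta>\<^sup>2 - (\<alpha> * b + d * \<beta>)\<^sup>2" unfolding abd trig(2) by algebra
  also have "\<dots> = r * e / \<tau>\<^sup>2"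
  proof -
    have "\<tau>\<^sup>2 * (r * \<nu>\<^sup>2 - (lam * r / \<tau>)\<^sup>2) = r * (\<tau>\<^sup>2 * \<nu>\<^sup>2 - r)"
      using \<tau> by (simp add: power_divide power_mult_distrib lam2 algebra_simps) (simp add: power2_eq_square)
    also have "\<tau>\<^sup>2 * \<nu>\<^sup>2 - r = e" using er by simp
    also have "r * e = \<tau>\<^sup>2 * (r * e / \<tau>\<^sup>2)" using \<tau> by simp
    finally show ?thesis
      unfolding a\<beta> \<alpha>\<beta> mult_cancel_left using \<tau> by auto
  qed
  finally show "ip22 (velocity \<gamma> x) (velocity \<gamma> x) = (lam + \<nu>\<^sup>2) * helix_B \<tau> lam \<nu> / \<tau>\<^sup>2"
    by (simp add: r_def e_def)
  have "ip22 (velocity \<gamma> x) (hopf_field \<kappa> (\<gamma> x)) = k / 2 *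
     (velocity \<gamma> x $ 2 * \<gamma> x $ 1 - velocity \<gamma> x $ 1 * \<gamma> x $ 2
      - velocity \<gamma> x $ 4 * \<gamma> x $ 3 + velocity \<gamma> x $ 3 * \<gamma> x $ 4)"
    by (simp add: ip22_def k_def algebra_simps)
  also have "velocity \<gamma> x $ 2 * \<gamma> x $ 1 - velocity \<gamma> x $ 1 * \<gamma> x $ 2
      - velocity \<gamma> x $ 4 * \<gamma> x $ 3 + velocity \<gamma> x $ 3 * \<gamma> x $ 4
      = \<alpha> * (a\<^sup>2 - d\<^sup>2) * (sinh (\<beta> * x))\<^sup>2 - \<alpha> * b\<^sup>2 * (cosh (\<beta> * x))\<^sup>2
        - \<beta> * b * d * ((cosh (\<beta> * x))\<^sup>2 - (sinh (\<beta> * x))\<^sup>2)"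
    unfolding vel unfolding \<gamma> vector_4_nth using trig(1)[of x] by algebra
  also have "\<dots> = - b * (\<alpha> * b + d * \<beta>)" unfolding abd trig(2) by algebra
  also have "k / 2 * (- b * (\<alpha> * b + d * \<beta>)) = - (b * k) / 2 * (\<alpha> * b + d * \<beta>)" by simp
  also have "\<dots> = - lam * r / \<tau>" unfolding bk \<alpha>\<beta> by simp
  finally show "ip22 (velocity \<gamma> x) (hopf_field \<kappa> (\<gamma> x)) = - lam * (lam + \<nu>\<^sup>2) / \<tau>"
    by (simp add: r_def)
qed


section \<open>The angle function of a helix surface\<close>

text \<open>The two hypotheses are the real and imaginary parts of orthogonality for the Hermitian
  form of signature (1,1) whose real part is \<open>ip22\<close>.\<close>

lemma complex_horizontal:
  assumes "\<kappa> > 0" "ip22 q a = 0" "ip22 a (hopf_field \<kappa> q) = 0"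
  shows "Complex (a$1) (a$2) * cnj (Complex (q$1) (q$2)) = Complex (a$3) (a$4) * cnj (Complex (q$3) (q$4))"
proof -
  have "ip22 a (hopf_field \<kappa> q) = sqrt \<kappa> / 2 * (a$2 * q$1 - a$1 * q$2 - (a$4 * q$3 - a$3 * q$4))"
    by (simp add: ip22_def algebra_simps)
  with assms(1,3) have "a$2 * q$1 - a$1 * q$2 = a$4 * q$3 - a$3 * q$4" by simp
  with assms(2) show ?thesis
    by (simp add: complex_eq_iff ip22_def algebra_simps)
qed

text \<open>Taking moduli in the Hermitian orthogonality relation and inserting the equation of
  \<open>ads \<kappa>\<close> gives \<open>*\<close>, which exhibits \<open>ip22 a a\<close> as a
  nonnegative multiple of the squared modulus of the first complex coordinate.\<close>

lemma ip22_horizontal: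
  assumes \<kappa>: "\<kappa> > 0" and q: "q \<in> ads \<kappa>"
    and a: "ip22 q a = 0" "ip22 a (hopf_field \<kappa> q) = 0"
  shows "ip22 a a \<ge> 0" and "ip22 a a = 0 \<Longrightarrow> a = 0"
proof -
  define R where "R = (q$3)\<^sup>2 + (q$4)\<^sup>2"
  have qR: "(q$1)\<^sup>2 + (q$2)\<^sup>2 = R - 4 / \<kappa>"
    using q by (simp add: R_def ads_def ip22_def power2_eq_square)
  then have "R > 0" using \<kappa> by (smt (verit) divide_pos_pos zero_le_power2)
  have "(cmod (Complex (a$1) (a$2)) * cmod (Complex (q$1) (q$2)))\<^sup>2
      = (cmod (Complex (a$3) (a$4)) * cmod (Complex (q$3) (q$4)))\<^sup>2"
    using arg_cong[OF complex_horizontal[OF \<kappa> a], of cmod] by (simp add: norm_mult)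
  then have "((a$1)\<^sup>2 + (a$2)\<^sup>2) * (R - 4 / \<kappa>) = ((a$3)\<^sup>2 + (a$4)\<^sup>2) * R"
    by (simp add: power_mult_distrib cmod_power2 qR) (simp add: R_def)
  then have *: "ip22 a a * R = 4 / \<kappa> * ((a$1)\<^sup>2 + (a$2)\<^sup>2)"
    and a34: "((a$3)\<^sup>2 + (a$4)\<^sup>2) * R = ((a$1)\<^sup>2 + (a$2)\<^sup>2) * (R - 4 / \<kappa>)"
    by (simp_all add: ip22_def power2_eq_square algebra_simps)
  show "ip22 a a \<ge> 0"
    using \<open>R > 0\<close> \<kappa> zero_le_mult_iff[of "ip22 a a" R] unfolding * by simp
  show "a = 0" if "ip22 a a = 0"
  proof -
    have "4 / \<kappa> * ((a$1)\<^sup>2 + (a$2)\<^sup>2) = 0" "4 / \<kappa> \<noteq> 0"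
      unfolding *[symmetric] that using \<kappa> by simp_all
    then have "(a$1)\<^sup>2 + (a$2)\<^sup>2 = 0" by (metis mult_eq_0_iff)
    moreover from this have "(a$3)\<^sup>2 + (a$4)\<^sup>2 = 0" using a34 \<open>R > 0\<close> by simp
    ultimately show ?thesis by (simp add: vec_eq_iff forall_4 sum_power2_eq_zero_iff)
  qed
qed

text \<open>Horizontal vectors form a complex line, in which being orthogonal to \<open>a\<close>
  rotated by a right angle means being a real multiple of \<open>a\<close>. The remainder
  \<open>c\<close> of the orthogonal projection onto \<open>a\<close> is Hermitian orthogonal to
  both \<open>a\<close> and \<open>q\<close>, and this forces it to vanish.\<close>

lemma horizontal_dependent:
  assumes \<kappa>: "\<kappa> > 0" and q: "q \<in> ads \<kappa>"
    and a: "ip22 q a = 0" "ip22 a (hopf_field \<kappa> q) = 0" and "a \<noteq> 0"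
    and b: "ip22 q b = 0" "ip22 b (hopf_field \<kappa> q) = 0"
    and ab: "ip22 a (hopf_field \<kappa> b) = 0"
  shows "\<exists>r. b = r *\<^sub>R a"
proof -
  define c where "c = b - (ip22 a b / ip22 a a) *\<^sub>R a"
  have "ip22 a a \<noteq> 0" using ip22_horizontal(2)[OF \<kappa> q a] \<open>a \<noteq> 0\<close> by blast
  then have "ip22 a c = 0" by (simp add: c_def ip22_linear)
  then have "ip22 c a = 0" by (simp add: ip22_commute)
  moreover have "ip22 a (hopf_field \<kappa> c) = 0"
    using linear_diff[OF bounded_linear.linear[OF bounded_linear_hopf_field]]
      linear_cmul[OF bounded_linear.linear[OF bounded_linear_hopf_field]]
    by (simp add: c_def ip22_linear ab ip22_hopf_field_self)
  \<comment> \<open>Here \<open>c\<close> takes the place of the base point in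
    \<open>complex_horizontal\<close>.\<close>
  ultimately have ac: "Complex (a$1) (a$2) * cnj (Complex (c$1) (c$2))
      = Complex (a$3) (a$4) * cnj (Complex (c$3) (c$4))"
    by (rule complex_horizontal[OF \<kappa>])
  define A1 A2 C1 C2 Q1 Q2 where defs: "A1 = Complex (a$1) (a$2)" "A2 = Complex (a$3) (a$4)"
    "C1 = Complex (c$1) (c$2)" "C2 = Complex (c$3) (c$4)"
    "Q1 = Complex (q$1) (q$2)" "Q2 = Complex (q$3) (q$4)"
  have c: "ip22 q c = 0" "ip22 c (hopf_field \<kappa> q) = 0"
    by (simp_all add: c_def ip22_linear a b)
  have eqs: "A1 * cnj C1 = A2 * cnj C2" "A1 * cnj Q1 = A2 * cnj Q2" "C1 * cnj Q1 = C2 * cnj Q2"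
    using ac complex_horizontal[OF \<kappa> a] complex_horizontal[OF \<kappa> c] by (simp_all add: defs)
  have "(cmod Q2)\<^sup>2 - (cmod Q1)\<^sup>2 = 4 / \<kappa>"
    using q unfolding defs ads_def ip22_def cmod_power2 by (simp add: power2_eq_square)
  then have "(cmod Q2)\<^sup>2 > (cmod Q1)\<^sup>2" using \<kappa> by (smt (verit) divide_pos_pos)
  then have "(cmod Q2)\<^sup>2 > 0" by (smt (verit) zero_le_power2)
  then have "Q2 \<noteq> 0" by auto
  have Q: "Q1 * cnj Q1 \<noteq> Q2 * cnj Q2"
    using \<open>(cmod Q2)\<^sup>2 > (cmod Q1)\<^sup>2\<close>
    unfolding complex_norm_square[symmetric] of_real_eq_iff by (rule less_imp_neq)
  \<comment> \<open>Eliminating \<open>A2\<close> and \<open>C2\<close> leaves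
    \<open>A1 * cnj C1\<close> times the difference of the squared moduli of \<open>Q2\<close> and
    \<open>Q1\<close>, which is \<open>4 / \<kappa>\<close>.\<close>
  have "A1 * cnj C1 * (Q2 * cnj Q2) = (A2 * cnj Q2) * cnj (C2 * cnj Q2)"
    by (simp add: eqs(1) mult_ac)
  also have "\<dots> = A1 * cnj C1 * (Q1 * cnj Q1)"
    unfolding eqs(2,3)[symmetric] by (simp add: mult_ac)
  finally have "A1 = 0 \<or> C1 = 0" using Q by auto
  moreover have "A1 \<noteq> 0"
  proof
    assume "A1 = 0"
    then have "A2 = 0" using eqs(2) \<open>Q2 \<noteq> 0\<close> by auto
    with \<open>A1 = 0\<close> \<open>a \<noteq> 0\<close> show False
      by (simp add: defs Complex_eq_0 vec_eq_iff forall_4)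
  qed
  ultimately have "C1 = 0" by blast
  then have "C2 = 0" using eqs(3) \<open>Q2 \<noteq> 0\<close> by auto
  with \<open>C1 = 0\<close> have "c = 0"
    by (simp add: defs Complex_eq_0 vec_eq_iff forall_4)
  then show ?thesis unfolding c_def by (metis eq_iff_diff_eq_0)
qed

text \<open>The contact condition: differentiating the orthogonality to \<open>H\<close> once more, the second
  derivatives of \<open>f\<close> cancel by symmetry, whereas the first order term is skew in \<open>u\<close> and \<open>v\<close>.\<close>

lemma horizontal_imp_isotropic:
  fixes f :: "'a::real_normed_vector \<Rightarrow> real^4"
  assumes U: "open U" and f: "Ck_on (Suc (Suc 0)) U f" and "x \<in> U"
    and horiz: "\<And>y v. y \<in> U \<Longrightarrow> ip22 (frechet_derivative f (at y) v) (hopf_field \<kappa> (f y)) = 0"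
  shows "ip22 (frechet_derivative f (at x) u) (hopf_field \<kappa> (frechet_derivative f (at x) v)) = 0"
proof -
  let ?D = "\<lambda>u v. frechet_derivative (\<lambda>y. frechet_derivative f (at y) u) (at x) v"
  let ?d = "frechet_derivative f (at x)"
  have "ip22 (?d u) (hopf_field \<kappa> (?d v)) + ip22 (?D u v) (hopf_field \<kappa> (f x)) = 0" for u v
  proof -
    have "(f has_derivative ?d) (at x)" "((\<lambda>y. frechet_derivative f (at y) u) has_derivative ?D u) (at x)"
      using f \<open>x \<in> U\<close> by (simp_all add: frechet_derivative_works[symmetric])
    then have "((\<lambda>y. ip22 (frechet_derivative f (at y) u) (hopf_field \<kappa> (f y))) has_derivative
        (\<lambda>v. ip22 (?d u) (hopf_field \<kappa> (?d v)) + ip22 (?D u v) (hopf_field \<kappa> (f x)))) (at x)"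
      by (intro bounded_bilinear.FDERIV[OF bounded_bilinear_ip22]
          bounded_linear.has_derivative[OF bounded_linear_hopf_field])
    moreover have "((\<lambda>y. ip22 (frechet_derivative f (at y) u) (hopf_field \<kappa> (f y))) has_derivative
        (\<lambda>v. 0)) (at x)"
      by (rule has_derivative_transform_within_open[of "\<lambda>_. 0" _ x UNIV U])
         (use U \<open>x \<in> U\<close> horiz in auto)
    ultimately have "(\<lambda>v. ip22 (?d u) (hopf_field \<kappa> (?d v)) + ip22 (?D u v) (hopf_field \<kappa> (f x))) = (\<lambda>v. 0)"
      by (rule has_derivative_unique)
    then show ?thesis by (rule fun_cong)
  qed
  from this[of u v] this[of v u] show ?thesis
    using second_derivative_symmetric[OF U f \<open>x \<in> U\<close>, of u v]
      ip22_hopf_field_skew[of \<kappa> "?d u" "?d v"] ip22_commute[of "?d v" "hopf_field \<kappa> (?d u)"]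
    by simp
qed

text \<open>The images of the two coordinate vectors would be tangent, horizontal and isotropic for
  the skew form, hence dependent, against injectivity of the derivative.\<close>

lemma no_horizontal_immersion:
  fixes f :: "real^2 \<Rightarrow> real^4"
  assumes \<kappa>: "\<kappa> > 0" and U: "open U" and f: "smooth_on U f" and "x \<in> U"
    and ads: "f ` U \<subseteq> ads \<kappa>" and inj: "inj (frechet_derivative f (at x))"
    and horiz: "\<And>y v. y \<in> U \<Longrightarrow> ip22 (frechet_derivative f (at y) v) (hopf_field \<kappa> (f y)) = 0"
  shows False
proof -
  let ?d = "frechet_derivative f (at x)"
  have f2: "Ck_on (Suc (Suc 0)) U f" using f by (simp only: smooth_on_def)
  then have d: "(f has_derivative ?d) (at x)"
    using \<open>x \<in> U\<close> by (simp add: frechet_derivative_works[symmetric])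
  then have lin: "linear ?d" by (rule has_derivative_linear)
  have tangent: "ip22 (f x) (?d v) = 0" for v
  proof -
    have "((\<lambda>y. ip22 (f y) (f y)) has_derivative (\<lambda>v. ip22 (f x) (?d v) + ip22 (?d v) (f x))) (at x)"
      by (intro bounded_bilinear.FDERIV[OF bounded_bilinear_ip22] d)
    moreover have "((\<lambda>y. ip22 (f y) (f y)) has_derivative (\<lambda>v. 0)) (at x)"
      by (rule has_derivative_transform_within_open[of "\<lambda>_. - 4 / \<kappa>" _ x UNIV U])
         (use U \<open>x \<in> U\<close> ads in \<open>auto simp: ads_def\<close>)
    ultimately have "(\<lambda>v. ip22 (f x) (?d v) + ip22 (?d v) (f x)) = (\<lambda>v. 0)"
      by (rule has_derivative_unique)
    from fun_cong[OF this, of v] show ?thesis by (simp add: ip22_commute)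
  qed
  define a where "a = ?d (axis 1 1)"
  define b where "b = ?d (axis 2 1)"
  have "a \<noteq> 0"
    using linear_injective_0[OF lin] inj unfolding a_def by (metis axis_eq_0_iff zero_neq_one)
  then obtain r where "b = r *\<^sub>R a"
    using horizontal_dependent[OF \<kappa>, of "f x" a b] tangent horiz[OF \<open>x \<in> U\<close>] ads \<open>x \<in> U\<close>
      horizontal_imp_isotropic[OF U f2 \<open>x \<in> U\<close> horiz]
    unfolding a_def b_def by blast
  then have "?d (axis 2 1) = ?d (r *\<^sub>R axis 1 1)"
    by (simp add: a_def b_def linear_cmul[OF lin])
  then have "(axis 2 1 :: real^2) = r *\<^sub>R axis 1 1" using inj by (simp add: inj_eq)
  then show False by (auto simp: vec_eq_iff axis_def dest!: spec[of _ 2])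
qed

lemma helix_surface_angle:
  assumes \<kappa>: "\<kappa> > 0" and \<tau>: "\<tau> > 0" and M: "helix_surface \<kappa> \<tau> M F N lam \<nu>"
  shows "lam \<in> {-1, 1}" and "lam + \<nu>\<^sup>2 > 0"
proof -
  have surf: "M \<noteq> {}" "F ` M \<subseteq> ads \<kappa>" "lam \<in> {-1, 1}"
    and N: "\<And>p. p \<in> M \<Longrightarrow> ip22 (F p) (N p) = 0" "\<And>p. p \<in> M \<Longrightarrow> berger \<kappa> \<tau> (F p) (N p) (N p) = lam"
    and chart: "\<And>p. p \<in> M \<Longrightarrow> \<exists>U \<psi>. immersion_chart M F U \<psi> \<and> p \<in> \<psi> ` U \<and> smooth_on U (N \<circ> \<psi>) \<and>
        (\<forall>u\<in>U. \<forall>v.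
           berger \<kappa> \<tau> (F (\<psi> u)) (N (\<psi> u)) (frechet_derivative (F \<circ> \<psi>) (at u) v) = 0)"
    and ang: "\<And>p. p \<in> M \<Longrightarrow> lam * berger \<kappa> \<tau> (F p) (N p) (E1 \<kappa> \<tau> (F p)) = \<nu>"
    using M unfolding helix_surface_def oriented_surface_def tangent_ads_def by auto
  show lam: "lam \<in> {-1, 1}" by (rule surf(3))
  \<comment> \<open>The component of \<open>N p\<close> orthogonal to \<open>E1\<close>. The sign is
    a plus because \<open>E1\<close> has square -1, while its product with \<open>N p\<close> is
    \<open>lam * \<nu>\<close>.\<close>
  define n where "n p = N p + (lam * \<nu>) *\<^sub>R E1 \<kappa> \<tau> (F p)" for p
  have n: "ip22 (F p) (n p) = 0" "ip22 (n p) (hopf_field \<kappa> (F p)) = 0" "ip22 (n p) (n p) = lam + \<nu>\<^sup>2"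
    if "p \<in> M" for p
  proof -
    have q: "F p \<in> ads \<kappa>" using that surf(2) by auto
    note E = berger_E1[OF \<kappa> \<tau> q]
    have gN: "\<tau> * ip22 (N p) (hopf_field \<kappa> (F p)) = lam * \<nu>"
      using ang[OF that] lam unfolding E by auto
    show "ip22 (F p) (n p) = 0"
      by (simp add: n_def N(1)[OF that] ip22_linear E1_def ip22_hopf_field_self)
    have "\<tau> * ip22 (n p) (hopf_field \<kappa> (F p)) = 0"
      using E(2)[unfolded E(1)] gN unfolding n_def ip22_linear real_scaleR_def by algebra
    then show horiz: "ip22 (n p) (hopf_field \<kappa> (F p)) = 0" using \<tau> by simp
    \<comment> \<open>On horizontal vectors the correction term of the Berger metric
      vanishes.\<close>
    have "ip22 (n p) (n p) = berger \<kappa> \<tau> (F p) (n p) (n p)"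
      by (simp add: berger_def horiz)
    also have "\<dots> = berger \<kappa> \<tau> (F p) (N p) (N p)
        + 2 * (lam * \<nu>) * berger \<kappa> \<tau> (F p) (N p) (E1 \<kappa> \<tau> (F p))
        + (lam * \<nu>)\<^sup>2 * berger \<kappa> \<tau> (F p) (E1 \<kappa> \<tau> (F p)) (E1 \<kappa> \<tau> (F p))"
      by (simp add: n_def berger_def ip22_linear ip22_commute power2_eq_square algebra_simps)
    also have "\<dots> = lam + \<nu>\<^sup>2"
      unfolding E(2) N(2)[OF that] unfolding E(1) gN using lam by (auto simp: power2_eq_square)
    finally show "ip22 (n p) (n p) = lam + \<nu>\<^sup>2" .
  qed
  obtain p where p: "p \<in> M" using surf(1) by auto
  have "lam + \<nu>\<^sup>2 \<ge> 0"
    using ip22_horizontal(1)[OF \<kappa>, of "F p" "n p"] n[OF p] surf(2) p by auto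
  moreover have "lam + \<nu>\<^sup>2 \<noteq> 0"
  proof
    assume 0: "lam + \<nu>\<^sup>2 = 0"
    then have "\<nu> \<noteq> 0" using lam by auto
    \<comment> \<open>If \<open>lam + \<nu>\<^sup>2\<close> vanishes, then \<open>n p\<close> is a
      horizontal null vector, hence zero by definiteness; the tangent planes are then horizontal
      throughout a chart.\<close>
    have N0: "N p = - (lam * \<nu>) *\<^sub>R E1 \<kappa> \<tau> (F p)" if "p \<in> M" for p
    proof -
      have "n p = 0" using ip22_horizontal(2)[OF \<kappa>, of "F p" "n p"] n[OF that] surf(2) that 0 by auto
      then show ?thesis by (simp add: n_def eq_neg_iff_add_eq_0)
    qed
    obtain U \<psi> where U: "immersion_chart M F U \<psi>" "p \<in> \<psi> ` U"
      and orth: "\<And>u v. u \<in> U \<Longrightarrow>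
        berger \<kappa> \<tau> (F (\<psi> u)) (N (\<psi> u)) (frechet_derivative (F \<circ> \<psi>) (at u) v) = 0"
      using chart[OF p] by blast
    then obtain x where x: "x \<in> U" by auto
    have U': "open U" "smooth_on U (F \<circ> \<psi>)" "inj (frechet_derivative (F \<circ> \<psi>) (at x))"
      and "openin (top_of_set M) (\<psi> ` U)"
      using U(1) x unfolding immersion_chart_def by auto
    then have sub: "\<psi> ` U \<subseteq> M" using openin_imp_subset by blast
    have "ip22 (frechet_derivative (F \<circ> \<psi>) (at y) v) (hopf_field \<kappa> ((F \<circ> \<psi>) y)) = 0"
      if y: "y \<in> U" for y v
    proof -
      let ?w = "frechet_derivative (F \<circ> \<psi>) (at y) v"
      have m: "\<psi> y \<in> M" and q: "F (\<psi> y) \<in> ads \<kappa>" using sub surf(2) y by auto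
      have "berger \<kappa> \<tau> (F (\<psi> y)) (N (\<psi> y)) ?w
          = - (lam * \<nu>) * berger \<kappa> \<tau> (F (\<psi> y)) ?w (E1 \<kappa> \<tau> (F (\<psi> y)))"
        by (simp only: N0[OF m] berger_scaleR berger_commute[of \<kappa> \<tau> _ "E1 \<kappa> \<tau> (F (\<psi> y))"])
      then have "- (lam * \<nu>) * (\<tau> * ip22 ?w (hopf_field \<kappa> (F (\<psi> y)))) = 0"
        using orth[OF y] unfolding berger_E1(1)[OF \<kappa> \<tau> q] by simp
      then show ?thesis using lam \<open>\<nu> \<noteq> 0\<close> \<tau> by auto
    qed
    moreover have "(F \<circ> \<psi>) ` U \<subseteq> ads \<kappa>" using sub surf(2) by auto
    ultimately show False
      using no_horizontal_immersion[OF \<kappa> U'(1,2) x _ U'(3)] by blast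
  qed
  ultimately show "lam + \<nu>\<^sup>2 > 0" by simp
qed

theorem proposition7p1:
  fixes \<kappa> \<tau> lam \<nu> :: real
    and M :: "'m::{t2_space,second_countable_topology} set"
    and F N :: "'m \<Rightarrow> real^4"
    and \<gamma> :: "real \<Rightarrow> real^4"
  assumes "\<kappa> > 0" and "\<tau> > 0"
    and "helix_surface \<kappa> \<tau> M F N lam \<nu>" and "\<nu> \<noteq> 0"
    and "\<gamma> = associated_curve \<kappa> \<tau> lam \<nu>"
  shows "(lam = -1 \<longrightarrow> spacelike_curve \<kappa> \<tau> \<gamma>) \<and>
         (lam = 1 \<longrightarrow> timelike_curve \<kappa> \<tau> \<gamma>) \<and>
         general_helix_with_axis \<kappa> \<tau> (E1 \<kappa> \<tau>) \<gamma> \<and>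
         meets_hopf_fibers_at_constant_angle \<kappa> \<tau> \<gamma> \<and>
         (\<forall>x. angle_function \<kappa> \<tau> (E1 \<kappa> \<tau>) \<gamma> x = - lam * sqrt (lam + \<nu>\<^sup>2))"
proof -
  note angle = helix_surface_angle[OF assms(1-3)]
  \<comment> \<open>The cases differ only in how the two constant products are computed; the results
    coincide, which is why a single expression gives the angle function.\<close>
  consider (pos) "helix_B \<tau> lam \<nu> > 0" | (zero) "helix_B \<tau> lam \<nu> = 0" | (neg) "helix_B \<tau> lam \<nu> < 0"
    by linarith
  then show ?thesis
  proof cases
    case pos
    then have "\<gamma> = curve_pos \<kappa> \<tau> lam \<nu>" using assms(5) by (simp add: associated_curve_def)
    with curve_pos_products[OF assms(1,2) angle assms(4) pos] show ?thesis
      by (intro helix_if_constant_products[OF assms(1,2) angle]) simp_all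
  next
    case zero
    then have "\<gamma> = curve_zero \<kappa> \<tau> lam \<nu>" using assms(5) by (simp add: associated_curve_def)
    with curve_zero_products[OF assms(1,2) angle(1) zero] show ?thesis
      by (intro helix_if_constant_products[OF assms(1,2) angle]) simp_all
  next
    case neg
    then have "\<gamma> = curve_neg \<kappa> \<tau> lam \<nu>" using assms(5) by (simp add: associated_curve_def)
    with curve_neg_products[OF assms(1,2) angle neg] show ?thesis
      by (intro helix_if_constant_products[OF assms(1,2) angle]) simp_all
  qed
qed

end
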